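(* Assume $\delta\in\left(0,\frac{b_1}{k_{1,N}}\right)$. The subgame perfect strategy $\pi^*=(\pi^*_{t_0},\dots,\pi^*_{t_{N-1}})$ of the correlation-constrained portfolio optimization problems (P1), (P2), …, (PN) described in the context is, for $n=1,2,\dots,N$, $$\pi^*_{t_{N-n}}=\min\{\bar\pi,\;R_{1,N-n}\},$$ where $$\bar\pi=\frac{1}{2\gamma\sigma_1\sqrt h}\ln\left(\frac{1+\theta\sqrt h}{1-\theta\sqrt h}\right),\qquad \theta=\frac{\mu_1}{\sigma_1},$$ and $R_{1,N-n}$ is the left root of the quadratic equation $$Q(x)=x^2\,(b_1^2-k_{1,n}^2\delta^2)+2b_1\,b_{2,N-n}(\pi^* )\,x+\left([b_{2,N-n}(\pi^* )]^2-\delta^2[k_{2,N-n}(\pi^* )]^2\right)=0 .$$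
   Context: **Market model.** The trading horizon $[0,T]$ is divided into $N$ periods, $h=T/N$, $t_n=nh$ for $n=0,\dots,N$. The randomness comes from three discrete time random walks $\epsilon_n^{s},\epsilon_n^{I},\epsilon_n^{b}$ defined on a complete probability space $(\Omega,\mathscr F_{t_N},\{\mathscr F_{t_n}\},\mathbb P)$, symmetric under $\mathbb P$, with $\mathbb P(\epsilon_n^j=\pm1)=1/2$ for $n=0,1,\dots,N$, $j\in\{s,I,b\}$. The bond is the numeraire and has zero interest rate. With $\Delta Y_{t_n}=Y_{t_{n+1}}-Y_{t_n}$: - stock: $\Delta S_{t_n}=S_{t_n}(\mu_1h+\sigma_1\sqrt h\,\epsilon_n^s)$, $S_0>0$, with drift $\mu_1$ and volatility $\sigma_1$ chosen so that $S$ remains positive; - income of the agent: $\Delta I_{t_n}=e^{kt_{n}}\,|\mu_2h+\sigma_2\sqrt h\,\epsilon_n^I|$; - benchmark index: $\Delta B_{t_n}=B_{t_n}\big(\mu_3h+\sigma_3\sqrt h(a_{31}\epsilon^s_n+a_{32}\epsilon^I_n+a_{33}\epsilon^b_n)\big)$, with $a_{31}>0$, $a_{32}>0$, $a_{33}=\sqrt{1-a_{31}^2-a_{32}^2}$, and drift $\mu_3$ and volatility $\sigma_3$ chosen so that $B$ is positive. If $\pi_{t_n}$ is the amount of wealth invested in stock at $t_n$ ($\mathscr F_{t_n}$-measurable), the wealth from investments satisfies $\Delta X_{t_n}=\pi_{t_n}(\mu_1h+\sigma_1\sqrt h\,\epsilon^s_n)$, $X_0=x\in\mathbb R$. Final wealth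 is $W_{t_N}=X_{t_N}+I_{t_N}$. The utility is $U(w)=-e^{-\gamma w}$, where $\gamma$ is the coefficient of absolute risk aversion. **Subgame perfect strategy** (backward induction). For $n=1,2,\dots,N$, with $\pi^*_{t_{N-n+1}},\dots,\pi^*_{t_{N-1}}$ already determined, $\pi^*_{t_{N-n}}$ is the solution of the problem $$(\mathrm{P}n)\qquad \max_{\pi_{t_{N-n}}}\ \mathbb E\left[-e^{-\gamma(X_{t_N}^{\pi}+I_{t_N})}\,\middle|\,\mathscr F_{t_{N-n}}\right]\quad\text{subject to}\quad \mathrm{correl}(W_{t_N},B_{t_N}\mid\mathscr F_{t_{N-n}})\le-\delta,$$ over $\mathscr F_{t_{N-n}}$-measurable $\pi_{t_{N-n}}$, where the strategy $\pi$ used is $\pi_{t_{N-n}}$ at time $t_{N-n}$ and $\pi^*_{t_i}$ at times $t_i$, $i=N-n+1,\dots,N-1$. Here $\mathrm{correl}(\cdot,\cdot\mid\mathscr F)$ is the conditional correlation. **Constants.** $\tilde\mu_3=1+h\mu_3$, $\theta_3=\sigma_3\sqrt h/\tilde\mu_3$, $b_1=\theta_3\sigma_1a_{31}\sqrt h$, $k_{1,n}^2=[(1+\theta_3^2)^n-1]\sigma_1^2h$ for $n=1,\dots,N$, $$\mathcal M=\frac{|\mu_2h+\sigma_2\sqrt h|-|\mu_2h-\sigma_2\sqrt h|}{2},$$ $$b_{2,N-n}(\pi)=\theta_3\left[\mathcal M a_{32}\sum_{s=N-n+1}^{N}e^{kt_s}+\sigma_1a_{31}\sqrt h\sum_{i=N-n+1}^{N-1}\pi_{t_i}\right],$$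 $$k_{2,N-n}^2(\pi)=[(1+\theta_3^2)^n-1]\left\{\mathcal M^2\sum_{s=N-n+1}^{N}e^{2kt_s}+\sigma_1^2h\sum_{i=N-n+1}^{N-1}\pi_{t_i}^2\right\}.$$
   Formalization: Income growth is dated consistently: either the sums in b_2, k_2 run over s=N-n..N-1, or income increments carry e^{kt_{n+1}}. The case M=0 with μ_1≥0 (no optimum in (P1)) is excluded; |θ√h|<1, γ>0 and independence of the walks are assumed. *)

theory Defs
  imports "HOL-Probability.Probability"
begin

section \<open>Market model\<close>

datatype driver = Stock | Income | Benchmark

text \<open>
  The field \<open>income_date\<close> (0 or 1) tells whether the income earned between \<open>t\<^sub>n\<close> and
  \<open>t\<^sub>n\<^sub>+\<^sub>1\<close> carries the growth factor \<open>e\<^sup>k\<^sup>t\<close> of the beginning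
  \<open>t = t\<^sub>n\<close> (0) or of the end \<open>t = t\<^sub>n\<^sub>+\<^sub>1\<close> (1) of the period. The source uses 0 in the income
  dynamics but 1 in the constants \<open>b\<^sub>2\<close> and \<open>k\<^sub>2\<close>. Both
  conventions are covered, each one used consistently.
\<close>

record 'a market =
  Omega :: "'a measure"
  eps :: "driver \<Rightarrow> nat \<Rightarrow> 'a \<Rightarrow> real"
  horizon :: real
  periods :: nat
  mu1 :: real
  sigma1 :: real
  mu2 :: real
  sigma2 :: real
  mu3 :: real
  sigma3 :: real
  a31 :: real
  a32 :: real
  income_growth :: real
  income_date :: nat
  risk_aversion :: real
  stock0 :: real
  income0 :: real
  benchmark0 :: real
  wealth0 :: real

definition step :: "'a market \<Rightarrow> real" where
  "step P = horizon P / real (periods P)"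

definition time :: "'a market \<Rightarrow> nat \<Rightarrow> real" where
  "time P n = real n * step P"

definition a33 :: "'a market \<Rightarrow> real" where
  "a33 P = sqrt (1 - (a31 P)\<^sup>2 - (a32 P)\<^sup>2)"

primrec stock :: "'a market \<Rightarrow> nat \<Rightarrow> 'a \<Rightarrow> real" where
  "stock P 0 \<omega> = stock0 P"
| "stock P (Suc n) \<omega> = stock P n \<omega>
     + stock P n \<omega> * (mu1 P * step P + sigma1 P * sqrt (step P) * eps P Stock n \<omega>)"

primrec income :: "'a market \<Rightarrow> nat \<Rightarrow> 'a \<Rightarrow> real" where
  "income P 0 \<omega> = income0 P"
| "income P (Suc n) \<omega> = income P n \<omega>
     + exp (income_growth P * time P (n + income_date P))
       * \<bar>mu2 P * step P + sigma2 P * sqrt (step P) * eps P Income n \<omega>\<bar>"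

primrec benchmark :: "'a market \<Rightarrow> nat \<Rightarrow> 'a \<Rightarrow> real" where
  "benchmark P 0 \<omega> = benchmark0 P"
| "benchmark P (Suc n) \<omega> = benchmark P n \<omega>
     + benchmark P n \<omega> * (mu3 P * step P + sigma3 P * sqrt (step P)
         * (a31 P * eps P Stock n \<omega> + a32 P * eps P Income n \<omega> + a33 P * eps P Benchmark n \<omega>))"

text \<open>\<open>\<pi> n\<close> is the amount invested in the stock between \<open>t\<^sub>n\<close> and \<open>t\<^sub>n\<^sub>+\<^sub>1\<close>.\<close>

primrec wealth :: "'a market \<Rightarrow> (nat \<Rightarrow> 'a \<Rightarrow> real) \<Rightarrow> nat \<Rightarrow> 'a \<Rightarrow> real" where
  "wealth P \<pi> 0 \<omega> = wealth0 P"
| "wealth P \<pi> (Suc n) \<omega> = wealth P \<pi> n \<omega>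
     + \<pi> n \<omega> * (mu1 P * step P + sigma1 P * sqrt (step P) * eps P Stock n \<omega>)"

definition final_wealth :: "'a market \<Rightarrow> (nat \<Rightarrow> 'a \<Rightarrow> real) \<Rightarrow> 'a \<Rightarrow> real" where
  "final_wealth P \<pi> \<omega> = wealth P \<pi> (periods P) \<omega> + income P (periods P) \<omega>"

definition utility :: "'a market \<Rightarrow> real \<Rightarrow> real" where
  "utility P w = - exp (- risk_aversion P * w)"

text \<open>
  The filtration generated by the random walks, augmented by the null sets. Since the innovation
  with index \<open>i\<close> drives the increment from \<open>t\<^sub>i\<close> to \<open>t\<^sub>i\<^sub>+\<^sub>1\<close>, it is known at \<open>t\<^sub>n\<close> iff \<open>i < n\<close>.
\<close>

definition filt :: "'a market \<Rightarrow> nat \<Rightarrow> 'a measure" where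
  "filt P n = sigma (space (Omega P))
     ({eps P j i -` A \<inter> space (Omega P) | j i A. i < n \<and> A \<in> sets borel} \<union> null_sets (Omega P))"

definition adapted :: "'a market \<Rightarrow> (nat \<Rightarrow> 'a \<Rightarrow> real) \<Rightarrow> bool" where
  "adapted P \<pi> \<longleftrightarrow> (\<forall>i<periods P. \<pi> i \<in> borel_measurable (filt P i))"

definition market_model :: "'a market \<Rightarrow> bool" where
  "market_model P \<longleftrightarrow>
     prob_space (Omega P) \<and> complete_measure (Omega P) \<and>
     horizon P > 0 \<and> periods P \<ge> 1 \<and>
     prob_space.indep_vars (Omega P) (\<lambda>_. borel) (\<lambda>(j, n). eps P j n) (UNIV \<times> {..<periods P}) \<and>
     (\<forall>j. \<forall>n<periods P.
        measure (Omega P) {\<omega> \<in> space (Omega P). eps P j n \<omega> = 1} = 1 / 2 \<and>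
        measure (Omega P) {\<omega> \<in> space (Omega P). eps P j n \<omega> = -1} = 1 / 2) \<and>
     stock0 P > 0 \<and> (\<forall>n\<le>periods P. AE \<omega> in Omega P. stock P n \<omega> > 0) \<and>
     (\<forall>n\<le>periods P. AE \<omega> in Omega P. benchmark P n \<omega> > 0) \<and>
     a31 P > 0 \<and> a32 P > 0 \<and> (a31 P)\<^sup>2 + (a32 P)\<^sup>2 \<le> 1 \<and>
     income_date P \<in> {0, 1} \<and> risk_aversion P > 0"


section \<open>Conditional correlation\<close>

definition cond_cov ::
    "'a measure \<Rightarrow> 'a measure \<Rightarrow> ('a \<Rightarrow> real) \<Rightarrow> ('a \<Rightarrow> real) \<Rightarrow> 'a \<Rightarrow> real" where
  "cond_cov M F X Y = real_cond_exp M F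
     (\<lambda>\<omega>. (X \<omega> - real_cond_exp M F X \<omega>) * (Y \<omega> - real_cond_exp M F Y \<omega>))"

text \<open>Where a conditional variance vanishes, the quotient is 0 by totality of division.\<close>

definition correl ::
    "'a measure \<Rightarrow> 'a measure \<Rightarrow> ('a \<Rightarrow> real) \<Rightarrow> ('a \<Rightarrow> real) \<Rightarrow> 'a \<Rightarrow> real" where
  "correl M F X Y \<omega> =
     cond_cov M F X Y \<omega> / (sqrt (cond_cov M F X X \<omega>) * sqrt (cond_cov M F Y Y \<omega>))"


section \<open>Subgame perfect strategies\<close>

text \<open>
  The strategy considered in problem \<open>(Pn)\<close>: \<open>q\<close> at \<open>t\<^sub>N\<^sub>-\<^sub>n\<close>, the already determined \<open>\<pi>\<close>
  afterwards. The investments \<open>\<rho>\<close> before \<open>t\<^sub>N\<^sub>-\<^sub>n\<close> are not determined at this stage of the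
  backward induction. A solution of \<open>(Pn)\<close> has to be one whatever they are.
\<close>

definition splice :: "'a market \<Rightarrow> nat \<Rightarrow> (nat \<Rightarrow> 'a \<Rightarrow> real) \<Rightarrow> ('a \<Rightarrow> real) \<Rightarrow>
    (nat \<Rightarrow> 'a \<Rightarrow> real) \<Rightarrow> nat \<Rightarrow> 'a \<Rightarrow> real" where
  "splice P n \<rho> q \<pi> i =
     (if i < periods P - n then \<rho> i else if i = periods P - n then q else \<pi> i)"

definition feasible :: "'a market \<Rightarrow> real \<Rightarrow> nat \<Rightarrow> (nat \<Rightarrow> 'a \<Rightarrow> real) \<Rightarrow> bool" where
  "feasible P \<delta> n \<pi> \<longleftrightarrow>
     (AE \<omega> in Omega P. correl (Omega P) (filt P (periods P - n))
        (final_wealth P \<pi>) (benchmark P (periods P)) \<omega> \<le> - \<delta>)"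

definition objective :: "'a market \<Rightarrow> nat \<Rightarrow> (nat \<Rightarrow> 'a \<Rightarrow> real) \<Rightarrow> 'a \<Rightarrow> real" where
  "objective P n \<pi> = real_cond_exp (Omega P) (filt P (periods P - n))
     (\<lambda>\<omega>. utility P (final_wealth P \<pi> \<omega>))"

definition solves_problem ::
    "'a market \<Rightarrow> real \<Rightarrow> nat \<Rightarrow> (nat \<Rightarrow> 'a \<Rightarrow> real) \<Rightarrow> ('a \<Rightarrow> real) \<Rightarrow> bool" where
  "solves_problem P \<delta> n \<pi> q \<longleftrightarrow>
     q \<in> borel_measurable (filt P (periods P - n)) \<and>
     (\<forall>\<rho>. adapted P \<rho> \<longrightarrow>
        feasible P \<delta> n (splice P n \<rho> q \<pi>) \<and>
        (\<forall>q' \<in> borel_measurable (filt P (periods P - n)).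
           feasible P \<delta> n (splice P n \<rho> q' \<pi>) \<longrightarrow>
           (AE \<omega> in Omega P. objective P n (splice P n \<rho> q' \<pi>) \<omega>
                              \<le> objective P n (splice P n \<rho> q \<pi>) \<omega>)))"

definition subgame_perfect :: "'a market \<Rightarrow> real \<Rightarrow> (nat \<Rightarrow> 'a \<Rightarrow> real) \<Rightarrow> bool" where
  "subgame_perfect P \<delta> \<pi> \<longleftrightarrow>
     (\<forall>n\<in>{1..periods P}. solves_problem P \<delta> n \<pi> (\<pi> (periods P - n)))"


section \<open>Constants\<close>

definition mu3_tilde :: "'a market \<Rightarrow> real" where
  "mu3_tilde P = 1 + step P * mu3 P"

definition theta3 :: "'a market \<Rightarrow> real" where
  "theta3 P = sigma3 P * sqrt (step P) / mu3_tilde P"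

definition b1 :: "'a market \<Rightarrow> real" where
  "b1 P = theta3 P * sigma1 P * a31 P * sqrt (step P)"

definition k1 :: "'a market \<Rightarrow> nat \<Rightarrow> real" where
  "k1 P n = sqrt (((1 + (theta3 P)\<^sup>2) ^ n - 1) * (sigma1 P)\<^sup>2 * step P)"

text \<open>
  For \<open>e = \<plusminus>1\<close>, \<open>\<bar>\<mu>\<^sub>2 h + \<sigma>\<^sub>2 \<surd>h e\<bar>\<close> is a constant plus \<open>income_amp P * e\<close>. If \<open>income_amp P = 0\<close>, the income is
  deterministic, and the final wealth given the information at \<open>t\<^sub>N\<^sub>-\<^sub>1\<close> is constant for the
  investment 0, for which the correlation is then undefined. That investment is the candidate
  solution at \<open>t\<^sub>N\<^sub>-\<^sub>1\<close> unless \<open>\<mu>\<^sub>1 < 0\<close>.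
\<close>

definition income_amp :: "'a market \<Rightarrow> real" where
  "income_amp P = (\<bar>mu2 P * step P + sigma2 P * sqrt (step P)\<bar>
                   - \<bar>mu2 P * step P - sigma2 P * sqrt (step P)\<bar>) / 2"

text \<open>
  \<open>b2 P n p\<close> and \<open>k2_sq P n p\<close> are the constants with index \<open>N - n\<close>. The growth factors are those
  of the income paid after \<open>t\<^sub>N\<^sub>-\<^sub>n\<close>, i.e. at \<open>t\<^sub>s\<close> for
  \<open>N - n + income_date \<le> s \<le> N - 1 + income_date\<close>.
\<close>

definition b2 :: "'a market \<Rightarrow> nat \<Rightarrow> (nat \<Rightarrow> real) \<Rightarrow> real" where
  "b2 P n p = theta3 P *
     (income_amp P * a32 P * (\<Sum>s = periods P - n + income_date P..<periods P + income_date P.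
                                exp (income_growth P * time P s))
      + sigma1 P * a31 P * sqrt (step P) * (\<Sum>i = periods P - n + 1..<periods P. p i))"

definition k2_sq :: "'a market \<Rightarrow> nat \<Rightarrow> (nat \<Rightarrow> real) \<Rightarrow> real" where
  "k2_sq P n p = ((1 + (theta3 P)\<^sup>2) ^ n - 1) *
     ((income_amp P)\<^sup>2 * (\<Sum>s = periods P - n + income_date P..<periods P + income_date P.
                            exp (2 * income_growth P * time P s))
      + (sigma1 P)\<^sup>2 * step P * (\<Sum>i = periods P - n + 1..<periods P. (p i)\<^sup>2))"

definition theta :: "'a market \<Rightarrow> real" where
  "theta P = mu1 P / sigma1 P"

definition pi_bar :: "'a market \<Rightarrow> real" where
  "pi_bar P = 1 / (2 * risk_aversion P * sigma1 P * sqrt (step P))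
     * ln ((1 + theta P * sqrt (step P)) / (1 - theta P * sqrt (step P)))"

definition Q :: "'a market \<Rightarrow> real \<Rightarrow> nat \<Rightarrow> (nat \<Rightarrow> real) \<Rightarrow> real \<Rightarrow> real" where
  "Q P \<delta> n p x = x\<^sup>2 * ((b1 P)\<^sup>2 - (k1 P n)\<^sup>2 * \<delta>\<^sup>2) + 2 * b1 P * b2 P n p * x
     + ((b2 P n p)\<^sup>2 - \<delta>\<^sup>2 * k2_sq P n p)"

definition is_left_root :: "(real \<Rightarrow> real) \<Rightarrow> real \<Rightarrow> bool" where
  "is_left_root f r \<longleftrightarrow> f r = 0 \<and> (\<forall>x. f x = 0 \<longrightarrow> r \<le> x)"

end

theory Submission
  imports Defs
begin

text \<open>
  Given the information at \<open>t\<^sub>N\<^sub>-\<^sub>n\<close>, the remaining shocks are uniform on \<open>{-1, 1}\<^sup>3\<^sup>n\<close> and independent of the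
  past, so every conditional expectation is a finite average over sign paths. When the later
  investments are the constants \<open>p\<close>, the correlation at the investment \<open>x\<close> is
  \<open>(b\<^sub>1 x + b\<^sub>2) / sqrt (k\<^sub>1\<^sup>2 x\<^sup>2 + k\<^sub>2\<^sup>2)\<close>, and squaring turns the constraint into \<open>x \<le> R\<close> for the left root
  \<open>R\<close> of \<open>Q\<close>, as long as the variance is positive. The objective is a negative factor, independent
  of \<open>x\<close>, times a strictly convex function of \<open>x\<close> with minimum at \<open>pi_bar\<close>. Its unique
  maximiser on \<open>x \<le> R\<close> is thus the constant \<open>min pi_bar R\<close>, which keeps the backward induction going.
\<close>

section \<open>Averages over sign paths\<close>

text \<open>The bound on \<delta> involves only \<open>k1 P (periods P)\<close>, but
  \<open>k1\<close> grows with the number of remaining periods, so the leading coefficient of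
  \<open>Q\<close> is positive at every stage. The squared constraint then holds outside the two
  roots, and only the left branch has negative correlation. The benchmark's conditional mean enters
  covariance and standard deviation as the same factor and cancels, so the correlation depends on
  the past only through the chosen investment. Uniqueness matters at each stage: it forces every
  subgame perfect strategy to be almost surely constant, which gives the preceding date a
  \<open>Q\<close> with deterministic coefficients. At zero conditional variance the correlation is
  0 by convention, hence infeasible; the alternative
  \<open>income_amp P \<noteq> 0 \<or> mu1 P < 0\<close> keeps the candidate away from that
  point.\<close>

definition signs :: "(real \<times> real \<times> real) set" where
  "signs = {-1, 1} \<times> {-1, 1} \<times> {-1, 1}"

definition avg1 :: "(real \<times> real \<times> real \<Rightarrow> real) \<Rightarrow> real" where
  "avg1 g = (\<Sum>t\<in>signs. g t) / 8"

text \<open>Paths are extensional on \<open>J\<close>, so there are exactly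
  \<open>8 ^ card J\<close> of them. For the same reason the shocks are passed through
  \<open>restrict\<close> later.\<close>

definition avg :: "nat set \<Rightarrow> ((nat \<Rightarrow> real \<times> real \<times> real) \<Rightarrow> real) \<Rightarrow> real" where
  "avg J F = (\<Sum>e\<in>PiE J (\<lambda>_. signs). F e) / 8 ^ card J"

lemma finite_signs [simp]: "finite signs"
  by (simp add: signs_def)

lemma card_signs [simp]: "card signs = 8"
  by (simp add: signs_def card_cartesian_product)

lemma avg1_eq:
  "avg1 g = (g (-1,-1,-1) + g (-1,-1,1) + g (-1,1,-1) + g (-1,1,1)
           + g (1,-1,-1) + g (1,-1,1) + g (1,1,-1) + g (1,1,1)) / 8"
proof -
  have sg: "signs = {(-1,-1,-1), (-1,-1,1), (-1,1,-1), (-1,1,1), (1,-1,-1), (1,-1,1), (1,1,-1), (1,1,1)}"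
    by (auto simp: signs_def)
  show ?thesis unfolding avg1_def sg by simp
qed

lemma avg_empty [simp]: "avg {} F = F (\<lambda>_. undefined)"
  by (simp add: avg_def)

text \<open>Averaging period by period; the moment formulas are proved by induction with it.\<close>

lemma avg_insert:
  assumes "finite J" "i \<notin> J"
  shows "avg (insert i J) F = avg1 (\<lambda>t. avg J (\<lambda>e. F (e(i := t))))"
proof -
  have inj: "inj_on (\<lambda>(t, e). e(i := t)) (signs \<times> PiE J (\<lambda>_. signs))"
  proof (rule inj_onI)
    fix x y
    assume xy: "x \<in> signs \<times> PiE J (\<lambda>_. signs)" "y \<in> signs \<times> PiE J (\<lambda>_. signs)"
      and "(\<lambda>(t, e). e(i := t)) x = (\<lambda>(t, e). e(i := t)) y"
    then obtain s t d e where x: "x = (s, d)" and y: "y = (t, e)" and eq: "d(i := s) = e(i := t)"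
      by (cases x; cases y) auto
    have de: "d \<in> PiE J (\<lambda>_. signs)" "e \<in> PiE J (\<lambda>_. signs)"
      using xy x y by auto
    \<comment> \<open>At \<open>i\<close> both functions are \<open>undefined\<close>, since they
      are extensional on a set without \<open>i\<close>.\<close>
    have "d j = e j" for j
      using fun_cong[OF eq, of j] assms(2) PiE_arb[OF de(1), of i] PiE_arb[OF de(2), of i]
      by (cases "j = i") auto
    then show "x = y"
      using fun_cong[OF eq, of i] by (auto simp: x y)
  qed
  have "(\<Sum>e\<in>PiE (insert i J) (\<lambda>_. signs). F e)
      = (\<Sum>t\<in>signs. \<Sum>e\<in>PiE J (\<lambda>_. signs). F (e(i := t)))"
    unfolding PiE_insert_eq sum.reindex[OF inj] sum.cartesian_product
    by (simp add: case_prod_beta)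
  then show ?thesis
    using assms by (simp add: avg_def avg1_def sum_divide_distrib mult.commute)
qed

section \<open>Linearity and moments of path averages\<close>

lemma avg_cmult: "avg J (\<lambda>e. c * F e) = c * avg J F"
  by (simp add: avg_def sum_distrib_left)

lemma avg_add: "avg J (\<lambda>e. F e + G e) = avg J F + avg J G"
  by (simp add: avg_def sum.distrib add_divide_distrib)

lemma avg_diff: "avg J (\<lambda>e. F e - G e) = avg J F - avg J G"
  by (simp add: avg_def sum_subtractf diff_divide_distrib)

lemma avg_const [simp]: "finite J \<Longrightarrow> avg J (\<lambda>_. c) = c"
  by (simp add: avg_def card_PiE)

lemma avg1_cmult: "avg1 (\<lambda>t. c * g t) = c * avg1 g" "avg1 (\<lambda>t. g t * c) = avg1 g * c"
  by (simp_all add: avg1_def sum_distrib_left sum_distrib_right)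

lemma avg1_add: "avg1 (\<lambda>t. g t + k t) = avg1 g + avg1 k"
  by (simp add: avg1_def sum.distrib add_divide_distrib)

lemma avg1_const [simp]: "avg1 (\<lambda>_. c) = c"
  by (simp add: avg1_def)

lemma avg_prod:
  assumes "finite J"
  shows "avg J (\<lambda>e. \<Prod>i\<in>J. f i (e i)) = (\<Prod>i\<in>J. avg1 (f i))"
proof -
  have "(\<Prod>i\<in>J. avg1 (f i)) = (\<Prod>i\<in>J. \<Sum>t\<in>signs. f i t) / 8 ^ card J"
    by (simp add: avg1_def prod_dividef)
  then show ?thesis
    using assms by (simp add: avg_def prod_sum_PiE)
qed

text \<open>Made for the covariance of additive wealth with the multiplicative benchmark. The term
  of period \<open>i\<close> meets only the factor of its own period; all other periods contribute
  \<mu>. Writing the mixed moment as \<open>c i * \<mu>\<close> gives every term the same power of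
  \<mu>.\<close>

lemma avg_sum_mult_prod:
  assumes "finite J" "avg1 g = \<mu>" "\<And>i. i \<in> J \<Longrightarrow> avg1 (\<lambda>t. f i t * g t) = c i * \<mu>"
  shows "avg J (\<lambda>e. (\<Sum>i\<in>J. f i (e i)) * (\<Prod>i\<in>J. g (e i))) = (\<Sum>i\<in>J. c i) * \<mu> ^ card J"
  using assms(1,3)
proof (induction J rule: finite_induct)
  case (insert i J)
  \<comment> \<open>Every summand is now a function of \<open>t\<close> times a function of
    \<open>e\<close>, so the two averages separate.\<close>
  have upd: "(\<Sum>j\<in>insert i J. f j ((e(i := t)) j)) * (\<Prod>j\<in>insert i J. g ((e(i := t)) j))
      = f i t * g t * (\<Prod>j\<in>J. g (e j)) + g t * ((\<Sum>j\<in>J. f j (e j)) * (\<Prod>j\<in>J. g (e j)))" for e t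
  proof -
    have "(\<Sum>j\<in>J. f j ((e(i := t)) j)) = (\<Sum>j\<in>J. f j (e j))"
      "(\<Prod>j\<in>J. g ((e(i := t)) j)) = (\<Prod>j\<in>J. g (e j))"
      using insert.hyps by (auto intro!: sum.cong prod.cong)
    then show ?thesis
      using insert.hyps by (simp add: algebra_simps)
  qed
  have "avg J (\<lambda>e. \<Prod>j\<in>J. g (e j)) = \<mu> ^ card J"
    using avg_prod[OF insert.hyps(1), of "\<lambda>_. g"] assms(2) by simp
  then show ?case
    using insert assms(2)
    by (simp only: avg_insert[OF insert.hyps] upd)
      (simp add: avg_add avg_cmult avg1_add avg1_cmult, simp add: algebra_simps)
qed simp

lemma avg_sum_centered:
  assumes "finite J" "\<And>i. i \<in> J \<Longrightarrow> avg1 (f i) = 0"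
  shows "avg J (\<lambda>e. \<Sum>i\<in>J. f i (e i)) = 0"
  using avg_sum_mult_prod[of J "\<lambda>_. 1" 1 f "\<lambda>_. 0"] assms by simp

text \<open>Distinct periods are independent and centred, so the cross terms average to 0.\<close>

lemma avg_sum_square:
  assumes "finite J" "\<And>i. i \<in> J \<Longrightarrow> avg1 (f i) = 0"
  shows "avg J (\<lambda>e. (\<Sum>i\<in>J. f i (e i))\<^sup>2) = (\<Sum>i\<in>J. avg1 (\<lambda>t. (f i t)\<^sup>2))"
  using assms
proof (induction J rule: finite_induct)
  case (insert i J)
  have upd: "(\<Sum>j\<in>insert i J. f j ((e(i := t)) j))\<^sup>2
      = (f i t)\<^sup>2 + 2 * f i t * (\<Sum>j\<in>J. f j (e j)) + (\<Sum>j\<in>J. f j (e j))\<^sup>2" for e t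
  proof -
    have "(\<Sum>j\<in>J. f j ((e(i := t)) j)) = (\<Sum>j\<in>J. f j (e j))"
      using insert.hyps by (auto intro!: sum.cong)
    then show ?thesis
      using insert.hyps by (simp add: power2_eq_square algebra_simps)
  qed
  show ?case
    using insert
    by (simp only: avg_insert[OF insert.hyps] upd)
      (simp add: avg_add avg_cmult avg1_add avg_sum_centered)
qed simp

section \<open>One-dimensional optimisation\<close>

text \<open>\<open>x0\<close> is the only zero of the derivative. The function decreases strictly
  before it and increases strictly after it.\<close>

lemma exp_sum_strict_min:
  fixes a b x y r :: real
  defines "x0 \<equiv> ln (a / b) / (a + b)"
  assumes "a > 0" "b > 0" "y \<le> r" "y \<noteq> min x0 r"
  shows "exp (- a * min x0 r) + exp (b * min x0 r) < exp (- a * y) + exp (b * y)"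
proof -
  let ?f = "\<lambda>x. exp (- a * x) + exp (b * x)"
  let ?f' = "\<lambda>x. b * exp (b * x) - a * exp (- a * x)"
  have der: "(?f has_real_derivative ?f' x) (at x)" for x
    by (auto intro!: derivative_eq_intros)
  have sgn_iff: "?f' x < 0 \<longleftrightarrow> x < x0" "?f' x > 0 \<longleftrightarrow> x > x0" for x
  proof -
    \<comment> \<open>With the factors moved into the exponents, the sign of the derivative is
      decided by a linear inequality.\<close>
    have a': "a * exp (- a * x) = exp (ln a - a * x)" and b': "b * exp (b * x) = exp (ln b + b * x)"
      using assms by (simp_all add: exp_diff exp_add exp_minus field_simps)
    have x0: "x0 = (ln a - ln b) / (a + b)"
      using assms by (simp add: x0_def ln_div)
    show "?f' x < 0 \<longleftrightarrow> x < x0" "?f' x > 0 \<longleftrightarrow> x > x0"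
      unfolding a' b' x0 using assms by (auto simp: field_simps)
  qed
  have dec: "?f v < ?f u" if "u < v" "v \<le> x0" for u v
  proof (rule DERIV_neg_imp_decreasing_open[OF that(1)])
    show "\<exists>y. (?f has_real_derivative y) (at x) \<and> y < 0" if "u < x" "x < v" for x
      using der sgn_iff(1)[of x] that \<open>v \<le> x0\<close> by (intro exI[of _ "?f' x"]) auto
  qed (intro continuous_intros)
  have inc: "?f u < ?f v" if "u < v" "x0 \<le> u" for u v
  proof (rule DERIV_pos_imp_increasing_open[OF that(1)])
    show "\<exists>y. (?f has_real_derivative y) (at x) \<and> y > 0" if "u < x" "x < v" for x
      using der sgn_iff(2)[of x] that \<open>x0 \<le> u\<close> by (intro exI[of _ "?f' x"]) auto
  qed (intro continuous_intros)
  show ?thesis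
    using assms(4,5) dec[of y "min x0 r"] inc[of "min x0 r" y] by (cases "x0 \<le> r"; cases y x0 rule: linorder_cases) auto
qed

text \<open>At the vertex \<open>- b / a\<close> of the linear part the quadratic is nonpositive, which puts the
  vertex between the two roots.\<close>

lemma left_root:
  fixes a b k K \<delta> :: real
  defines "f \<equiv> \<lambda>x. x\<^sup>2 * (a\<^sup>2 - k\<^sup>2 * \<delta>\<^sup>2) + 2 * a * b * x + (b\<^sup>2 - \<delta>\<^sup>2 * K)"
  assumes "a > 0" "\<delta> > 0" "k \<ge> 0" "k * \<delta> < a" "K \<ge> 0"
  shows ex_left_root: "\<exists>r. is_left_root f r"
    and left_root_iff: "is_left_root f r \<Longrightarrow>
      (a * x + b) / sqrt (k\<^sup>2 * x\<^sup>2 + K) \<le> - \<delta> \<longleftrightarrow> x \<le> r \<and> k\<^sup>2 * x\<^sup>2 + K > 0"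
proof -
  define A where "A = a\<^sup>2 - k\<^sup>2 * \<delta>\<^sup>2"
  define y where "y = - b / a"
  \<comment> \<open>A quarter of the discriminant.\<close>
  define \<Delta> where "\<Delta> = (a * b)\<^sup>2 - A * (b\<^sup>2 - \<delta>\<^sup>2 * K)"
  define r1 r2 where "r1 = (- (a * b) - sqrt \<Delta>) / A" and "r2 = (- (a * b) + sqrt \<Delta>) / A"
  have "(k * \<delta>)\<^sup>2 < a\<^sup>2"
    using assms by (intro power_strict_mono) auto
  then have A: "A > 0"
    by (simp add: A_def power_mult_distrib)
  have \<Delta>: "\<Delta> \<ge> 0"
  proof -
    have "\<Delta> = k\<^sup>2 * \<delta>\<^sup>2 * b\<^sup>2 + A * \<delta>\<^sup>2 * K"
      by (simp add: \<Delta>_def A_def algebra_simps power2_eq_square)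
    then show ?thesis using A assms by simp
  qed
  have r12: "r1 \<le> r2"
    using A \<Delta> by (simp add: r1_def r2_def divide_right_mono)
  have f_eq: "f x = A * (x - r1) * (x - r2)" for x
  proof -
    \<comment> \<open>Multiplying by \<open>A\<close> clears the denominators of the roots.\<close>
    have "A * (A * (x - r1) * (x - r2)) = (A * x - A * r1) * (A * x - A * r2)"
      by (simp add: algebra_simps)
    also have "\<dots> = (A * x + a * b + sqrt \<Delta>) * (A * x + a * b - sqrt \<Delta>)"
    proof -
      have "A * r1 = - (a * b) - sqrt \<Delta>" "A * r2 = - (a * b) + sqrt \<Delta>"
        using A by (simp_all add: r1_def r2_def)
      then show ?thesis by (simp only:) (simp add: algebra_simps)
    qed
    also have "\<dots> = (A * x + a * b)\<^sup>2 - (sqrt \<Delta>)\<^sup>2"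
      by (simp add: algebra_simps power2_eq_square)
    also have "\<dots> = (A * x + a * b)\<^sup>2 - \<Delta>"
      using \<Delta> by simp
    also have "\<dots> = A * f x"
      unfolding f_def A_def[symmetric] \<Delta>_def by (simp add: algebra_simps power2_eq_square)
    finally show ?thesis using A by simp
  qed
  have lr: "is_left_root f r \<longleftrightarrow> r = r1" for r
    using A r12 by (auto simp: is_left_root_def f_eq intro: antisym)
  then show "\<exists>r. is_left_root f r" by blast
  \<comment> \<open>The quadratic compares the squares of the two sides of the constraint.\<close>
  have fD: "f x = (a * x + b)\<^sup>2 - \<delta>\<^sup>2 * (k\<^sup>2 * x\<^sup>2 + K)" for x
    by (simp add: f_def algebra_simps power2_eq_square)
  have "f y \<le> 0"
    unfolding fD using assms by (simp add: y_def)
  then have "(y - r1) * (y - r2) \<le> 0"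
    using A by (simp add: f_eq mult.assoc mult_le_0_iff)
  then have y: "r1 \<le> y" "y \<le> r2"
    using r12 by (auto simp: mult_le_0_iff)
  assume "is_left_root f r"
  then have r: "r = r1" by (simp add: lr)
  let ?D = "k\<^sup>2 * x\<^sup>2 + K"
  have D: "?D \<ge> 0" using assms by simp
  show "(a * x + b) / sqrt ?D \<le> - \<delta> \<longleftrightarrow> x \<le> r \<and> ?D > 0"
  proof (cases "?D = 0")
    \<comment> \<open>The quotient is 0 by division by zero, and 0 exceeds
      \<open>- \<delta>\<close>: both sides are false.\<close>
    case True
    then show ?thesis using assms by simp
  next
    case False
    then have D: "?D > 0" using D by simp
    have sq: "(\<delta> * sqrt ?D)\<^sup>2 = \<delta>\<^sup>2 * ?D"
      using D by (simp add: power_mult_distrib)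
    have pos: "\<delta> * sqrt ?D > 0" using D assms by simp
    have xy: "a * x + b \<le> 0 \<longleftrightarrow> x \<le> y" "a * x + b < 0 \<longleftrightarrow> x < y"
      using assms by (auto simp: y_def field_simps)
    have "(a * x + b) / sqrt ?D \<le> - \<delta> \<longleftrightarrow> \<delta> * sqrt ?D \<le> - (a * x + b)"
      using D pos_divide_le_eq[of "sqrt ?D" "a * x + b" "- \<delta>"] by auto
    also have "\<dots> \<longleftrightarrow> x \<le> r1"
    proof
      assume le: "\<delta> * sqrt ?D \<le> - (a * x + b)"
      then have "(\<delta> * sqrt ?D)\<^sup>2 \<le> (- (a * x + b))\<^sup>2"
        using pos by (intro power_mono) auto
      then have "f x \<ge> 0"
        unfolding fD sq power2_minus by simp
      then have "(x - r1) * (x - r2) \<ge> 0"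
        using A by (simp add: f_eq mult.assoc zero_le_mult_iff)
      \<comment> \<open>Squaring also admits the points right of \<open>r2\<close>. The sign of the
        linear part, which is negative only left of \<open>y\<close>, excludes them.\<close>
      moreover have "x < r2" using le pos xy y by linarith
      ultimately show "x \<le> r1" by (auto simp: zero_le_mult_iff)
    next
      assume "x \<le> r1"
      then have "f x \<ge> 0"
        unfolding f_eq using A r12 by (simp add: mult.assoc zero_le_mult_iff)
      then have "(\<delta> * sqrt ?D)\<^sup>2 \<le> (- (a * x + b))\<^sup>2"
        unfolding fD sq power2_minus by simp
      moreover have "- (a * x + b) \<ge> 0"
        using xy y \<open>x \<le> r1\<close> by linarith
      ultimately show "\<delta> * sqrt ?D \<le> - (a * x + b)"
        by (rule power2_le_imp_le)
    qed
    finally show ?thesis using D r by simp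
  qed
qed

section \<open>Conditional expectations given the past shocks\<close>

definition shock :: "'a market \<Rightarrow> nat \<Rightarrow> 'a \<Rightarrow> real \<times> real \<times> real" where
  "shock P i \<omega> = (eps P Stock i \<omega>, eps P Income i \<omega>, eps P Benchmark i \<omega>)"

definition shocks_are :: "'a market \<Rightarrow> nat set \<Rightarrow> (nat \<Rightarrow> real \<times> real \<times> real) \<Rightarrow> 'a set" where
  "shocks_are P J e = {\<omega> \<in> space (Omega P). \<forall>i\<in>J. shock P i \<omega> = e i}"

lemma UNIV_driver: "(UNIV :: driver set) = {Stock, Income, Benchmark}"
  using driver.exhaust by blast

lemma finite_driver [simp]: "finite (UNIV :: driver set)"
  by (simp add: UNIV_driver)

lemma mem_signs_iff: "(s, i, b) \<in> signs \<longleftrightarrow> s \<in> {-1, 1} \<and> i \<in> {-1, 1} \<and> b \<in> {-1, 1}"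
  unfolding signs_def by (simp only: mem_Sigma_iff)

lemma card_driver [simp]: "card (UNIV :: driver set) = 3"
  by (simp add: UNIV_driver)

locale market_setting =
  fixes P :: "'a market"
  assumes model: "market_model P"

sublocale market_setting \<subseteq> prob_space "Omega P"
  using model by (simp add: market_model_def)

context market_setting
begin

lemma step_pos: "step P > 0"
  using model by (simp add: market_model_def step_def)

lemma periods_pos: "periods P > 0"
  using model by (simp add: market_model_def)

lemma eps_indep:
  "indep_vars (\<lambda>_. borel) (\<lambda>(j, n). eps P j n) (UNIV \<times> {..<periods P})"
  using model by (simp add: market_model_def)

lemma eps_measurable [measurable]: "i < periods P \<Longrightarrow> eps P j i \<in> borel_measurable (Omega P)"
  using eps_indep by (auto simp: indep_vars_def2)

lemma prob_eps:
  assumes "i < periods P"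
  shows "prob {\<omega> \<in> space (Omega P). eps P j i \<omega> = 1} = 1 / 2"
    and "prob {\<omega> \<in> space (Omega P). eps P j i \<omega> = -1} = 1 / 2"
  using model assms by (simp_all add: market_model_def)

text \<open>The model gives only the probabilities of the values 1 and -1; they already add up to
  1.\<close>

lemma AE_eps:
  assumes "i < periods P"
  shows "AE \<omega> in Omega P. eps P j i \<omega> \<in> {-1, 1}"
proof -
  have [measurable]: "eps P j i \<in> borel_measurable (Omega P)" using assms by simp
  have "{\<omega> \<in> space (Omega P). eps P j i \<omega> \<in> {-1, 1}}
      = {\<omega> \<in> space (Omega P). eps P j i \<omega> = 1} \<union> {\<omega> \<in> space (Omega P). eps P j i \<omega> = -1}"
    by auto
  then have "prob {\<omega> \<in> space (Omega P). eps P j i \<omega> \<in> {-1, 1}}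
      = prob {\<omega> \<in> space (Omega P). eps P j i \<omega> = 1} + prob {\<omega> \<in> space (Omega P). eps P j i \<omega> = -1}"
    by (simp only:) (rule finite_measure_Union; auto)
  also have "\<dots> = 1" using prob_eps[OF assms, of j] by simp
  finally show ?thesis by (subst (asm) prob_Collect_eq_1) auto
qed

lemma AE_shock: "AE \<omega> in Omega P. \<forall>i<periods P. shock P i \<omega> \<in> signs"
proof -
  have "AE \<omega> in Omega P. \<forall>i\<in>{..<periods P}. \<forall>j\<in>UNIV. eps P j i \<omega> \<in> {-1, 1}"
    by (intro AE_finite_allI) (simp_all add: AE_eps[simplified])
  then show ?thesis by eventually_elim (simp add: shock_def mem_signs_iff)
qed

section \<open>The augmented filtration\<close>

lemma space_filt [simp]: "space (filt P m) = space (Omega P)"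
  unfolding filt_def by (rule space_measure_of) (auto dest: sets.sets_into_space)

lemma sets_filt:
  "sets (filt P m) = sigma_sets (space (Omega P))
     ({eps P j i -` A \<inter> space (Omega P) | j i A. i < m \<and> A \<in> sets borel} \<union> null_sets (Omega P))"
  unfolding filt_def by (rule sets_measure_of) (auto dest: sets.sets_into_space)

lemma sets_filt_mono: "i \<le> m \<Longrightarrow> sets (filt P i) \<subseteq> sets (filt P m)"
  unfolding sets_filt by (rule sigma_sets_mono') (use less_le_trans in blast)

lemma measurable_filt_mono:
  "f \<in> borel_measurable (filt P i) \<Longrightarrow> i \<le> m \<Longrightarrow> f \<in> borel_measurable (filt P m)"
  using sets_filt_mono[of i m] by (auto simp: measurable_def)

lemma eps_measurable_filt: "i < m \<Longrightarrow> eps P j i \<in> borel_measurable (filt P m)"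
  unfolding measurable_def by (auto simp: sets_filt intro!: sigma_sets.Basic)

lemma subalg_filt:
  assumes "m \<le> periods P"
  shows "subalgebra (Omega P) (filt P m)"
proof -
  have "eps P j i -` A \<inter> space (Omega P) \<in> events" if "i < m" "A \<in> sets borel" for j i A
    using eps_measurable[of i j] that assms by (intro measurable_sets) simp_all
  then have "{eps P j i -` A \<inter> space (Omega P) | j i A. i < m \<and> A \<in> sets borel}
      \<union> null_sets (Omega P) \<subseteq> events"
    by blast
  then show ?thesis
    unfolding subalgebra_def sets_filt by (simp only: space_filt sets.sigma_sets_subset simp_thms)
qed

lemma measurable_filt_Omega:
  "f \<in> borel_measurable (filt P m) \<Longrightarrow> m \<le> periods P \<Longrightarrow> f \<in> borel_measurable (Omega P)"
  using subalg_filt measurable_from_subalg by blast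

section \<open>Shock patterns: probabilities and independence of the past\<close>

lemma shocks_are_sets:
  assumes "J \<subseteq> {..<periods P}"
  shows "shocks_are P J e \<in> events"
proof -
  have J: "finite J" using assms finite_subset by blast
  have "shocks_are P J e = {\<omega> \<in> space (Omega P). \<forall>i\<in>J. eps P Stock i \<omega> = fst (e i)
      \<and> eps P Income i \<omega> = fst (snd (e i)) \<and> eps P Benchmark i \<omega> = snd (snd (e i))}"
    by (auto simp: shocks_are_def shock_def prod_eq_iff)
  moreover have "{\<omega> \<in> space (Omega P). eps P Stock i \<omega> = fst (e i)
      \<and> eps P Income i \<omega> = fst (snd (e i)) \<and> eps P Benchmark i \<omega> = snd (snd (e i))} \<in> events"
    if "i \<in> J" for i
  proof -
    have [measurable]: "eps P j i \<in> borel_measurable (Omega P)" for j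
      using that assms by auto
    show ?thesis by measurable
  qed
  ultimately show ?thesis using J by (simp only:) (rule sets.sets_Collect_finite_All; blast)
qed

text \<open>The shape expected by \<open>indep_varsD\<close>. For empty \<open>J\<close> the
  intersection would be \<open>UNIV\<close> instead of the sample space.\<close>

lemma shocks_are_eq_Inter:
  assumes "J \<noteq> {}"
  shows "shocks_are P J e = (\<Inter>(j, i)\<in>UNIV \<times> J. eps P j i -`
     {case j of Stock \<Rightarrow> fst (e i) | Income \<Rightarrow> fst (snd (e i)) | Benchmark \<Rightarrow> snd (snd (e i))}
     \<inter> space (Omega P))"
proof -
  have "shock P i \<omega> = t \<longleftrightarrow> (\<forall>j. eps P j i \<omega>
      = (case j of Stock \<Rightarrow> fst t | Income \<Rightarrow> fst (snd t) | Benchmark \<Rightarrow> snd (snd t)))" for i \<omega> t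
    by (auto simp: shock_def prod_eq_iff split: driver.split)
  then have "\<omega> \<in> shocks_are P J e \<longleftrightarrow> \<omega> \<in> space (Omega P) \<and> (\<forall>i\<in>J. \<forall>j. eps P j i \<omega>
      = (case j of Stock \<Rightarrow> fst (e i) | Income \<Rightarrow> fst (snd (e i)) | Benchmark \<Rightarrow> snd (snd (e i))))" for \<omega>
    by (simp only: shocks_are_def mem_Collect_eq)
  then show ?thesis
    using assms by (intro set_eqI) (simp only: INT_iff mem_Sigma_iff split_paired_Ball_Sigma
      case_prod_conv Int_iff vimage_eq singleton_iff, blast)
qed

lemma prob_shocks_are:
  assumes "J \<subseteq> {..<periods P}" "J \<noteq> {}" "\<And>i. i \<in> J \<Longrightarrow> e i \<in> signs"
  shows "prob (shocks_are P J e) = 1 / 8 ^ card J"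
proof -
  define v where "v j i = (case j of Stock \<Rightarrow> fst (e i) | Income \<Rightarrow> fst (snd (e i))
    | Benchmark \<Rightarrow> snd (snd (e i)))" for j i
  have J: "finite J" using assms(1) finite_subset by blast
  have v: "v j i = 1 \<or> v j i = -1" if "i \<in> J" for i j
    using assms(3)[OF that] by (cases j) (auto simp: v_def signs_def)
  have pv: "prob (eps P j i -` {v j i} \<inter> space (Omega P)) = 1 / 2" if "i \<in> J" for i j
  proof -
    have "eps P j i -` {c} \<inter> space (Omega P) = {\<omega> \<in> space (Omega P). eps P j i \<omega> = c}" for c
      by auto
    moreover have "i < periods P" using that assms(1) by blast
    ultimately show ?thesis
      using v[OF that, of j] prob_eps[of i j] by (elim disjE) simp_all
  qed
  have "shocks_are P J e
      = (\<Inter>x\<in>UNIV \<times> J. (case x of (j, i) \<Rightarrow> eps P j i) -` {v (fst x) (snd x)} \<inter> space (Omega P))"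
    unfolding shocks_are_eq_Inter[OF assms(2)] v_def case_prod_beta ..
  also have "prob \<dots> = (\<Prod>x\<in>UNIV \<times> J. prob ((case x of (j, i) \<Rightarrow> eps P j i) -` {v (fst x) (snd x)} \<inter> space (Omega P)))"
    using assms J by (intro indep_varsD[OF eps_indep]) auto
  also have "\<dots> = (\<Prod>x\<in>(UNIV :: driver set) \<times> J. 1 / 2)"
    using pv by (intro prod.cong refl) (simp add: case_prod_beta mem_Times_iff)
  also have "\<dots> = (1 / 2) ^ (3 * card J)"
    by (simp add: card_cartesian_product)
  also have "\<dots> = 1 / 8 ^ card J"
    by (simp add: power_mult power_divide)
  finally show ?thesis .
qed

text \<open>Completing the filtration does not affect independence from the later shocks, because each
  event of the completion agrees up to a null set with an event of the raw filtration.\<close>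

lemma prob_filt_Int_shocks:
  assumes "m < periods P" "A \<in> sets (filt P m)" "e \<in> PiE {m..<periods P} (\<lambda>_. signs)"
  shows "prob (A \<inter> shocks_are P {m..<periods P} e) = prob A / 8 ^ (periods P - m)"
proof -
  define E where "E = (\<lambda>x. {(case x of (j, i) \<Rightarrow> eps P j i) -` B \<inter> space (Omega P) | B. B \<in> sets borel})"
  \<comment> \<open>\<open>True\<close> collects the innovations known at time \<open>m\<close>,
    \<open>False\<close> the later ones.\<close>
  define I where "I = case_bool (UNIV \<times> {..<m}) ((UNIV :: driver set) \<times> {m..<periods P})"
  let ?G = "\<lambda>b. sigma_sets (space (Omega P)) (\<Union>x\<in>I b. E x)"
  have E_events: "E (j, i) \<subseteq> events" if "i < periods P" for j i
    using measurable_sets[OF eps_measurable[OF that]] by (auto simp: E_def)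
  have "indep_sets ?G UNIV"
  proof (rule indep_sets_collect_sigma)
    have "(\<Union>b. I b) = UNIV \<times> {..<periods P}"
      using assms(1) by (auto simp: I_def UNIV_bool)
    moreover have "indep_sets E (UNIV \<times> {..<periods P})"
      using eps_indep unfolding indep_vars_def2 E_def by simp
    ultimately show "indep_sets E (\<Union>b. I b)" by simp
    show "Int_stable (E x)" for x
      unfolding Int_stable_def E_def by (auto, rule_tac x = "B \<inter> Ba" in exI, auto)
    show "disjoint_family I"
      by (auto simp: disjoint_family_on_def I_def split: bool.split)
  qed
  then have ind: "indep_set (?G True) (?G False)"
    unfolding indep_set_def by (rule indep_sets_cong[THEN iffD1, rotated -1]) (auto split: bool.split)
  have "\<exists>A'\<in>?G True. AE \<omega> in Omega P. \<omega> \<in> A \<longleftrightarrow> \<omega> \<in> A'"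
    using assms(2) unfolding sets_filt
  proof (induction rule: sigma_sets.induct)
    case (Basic A)
    then consider j i B where "A = eps P j i -` B \<inter> space (Omega P)" "i < m" "B \<in> sets borel"
      | "A \<in> null_sets (Omega P)" by blast
    then show ?case
    proof cases
      case 1
      then have "A \<in> ?G True"
        by (intro sigma_sets.Basic UN_I[of "(j, i)"]) (auto simp: E_def I_def)
      then show ?thesis by auto
    next
      case 2
      \<comment> \<open>A null set of the completion is matched with the empty set, which belongs to
        the raw filtration.\<close>
      then show ?thesis
        by (intro bexI[of _ "{}"] sigma_sets.Empty) (auto dest: AE_not_in)
    qed
  next
    case Empty
    then show ?case by (intro bexI[of _ "{}"] sigma_sets.Empty) auto
  next
    case (Compl A)
    then obtain A' where "A' \<in> ?G True" "AE \<omega> in Omega P. \<omega> \<in> A \<longleftrightarrow> \<omega> \<in> A'" by blast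
    then show ?case
      by (intro bexI[of _ "space (Omega P) - A'"] sigma_sets.Compl) auto
  next
    case (Union A)
    then have "\<forall>k. \<exists>A'. A' \<in> ?G True \<and> (AE \<omega> in Omega P. \<omega> \<in> A k \<longleftrightarrow> \<omega> \<in> A')" by blast
    then obtain A' where A': "\<And>k. A' k \<in> ?G True" "\<And>k. AE \<omega> in Omega P. \<omega> \<in> A k \<longleftrightarrow> \<omega> \<in> A' k"
      by metis
    from A'(2) have "AE \<omega> in Omega P. \<forall>k. \<omega> \<in> A k \<longleftrightarrow> \<omega> \<in> A' k"
      by (simp add: AE_all_countable)
    then show ?case
      by (intro bexI[of _ "\<Union>k. A' k"] sigma_sets.Union A'(1)) auto
  qed
  then obtain A' where A': "A' \<in> ?G True" "AE \<omega> in Omega P. \<omega> \<in> A \<longleftrightarrow> \<omega> \<in> A'" by blast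
  let ?D = "shocks_are P {m..<periods P} e"
  \<comment> \<open>The pattern is a finite intersection of generators with later indices.\<close>
  have D: "?D \<in> ?G False"
  proof -
    have E_Pow: "(\<Union>x\<in>I False. E x) \<subseteq> Pow (space (Omega P))"
      by (auto simp: E_def)
    have ne: "{m..<periods P} \<noteq> {}" using assms(1) by simp
    have "?D \<in> sets (sigma (space (Omega P)) (\<Union>x\<in>I False. E x))"
      unfolding shocks_are_eq_Inter[OF ne]
    proof (rule sets.finite_INT)
      show "(case x of (j, i) \<Rightarrow> eps P j i -` {case j of Stock \<Rightarrow> fst (e i) | Income \<Rightarrow> fst (snd (e i))
          | Benchmark \<Rightarrow> snd (snd (e i))} \<inter> space (Omega P))
        \<in> sets (sigma (space (Omega P)) (\<Union>x\<in>I False. E x))"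
        if "x \<in> UNIV \<times> {m..<periods P}" for x
        unfolding sets_measure_of[OF E_Pow]
        using that by (intro sigma_sets.Basic UN_I[of x]) (auto simp: E_def I_def)
    qed (use ne in auto)
    then show ?thesis by (simp add: sets_measure_of[OF E_Pow])
  qed
  have events: "?G b \<subseteq> events" for b
    using ind by (cases b) (auto simp: indep_set_def indep_sets_def split: bool.splits)
  have meas: "A \<in> events" "A' \<in> events" "?D \<in> events"
    using assms(1,2) subalg_filt[of m] A' D events by (auto simp: subalgebra_def less_imp_le)
  have "prob (A \<inter> ?D) = prob (A' \<inter> ?D)"
    using A'(2) meas by (intro finite_measure_eq_AE) auto
  also have "\<dots> = prob A' * prob ?D"
    using indep_setD[OF ind A'(1) D] .
  also have "prob A' = prob A"
    using A'(2) meas by (intro finite_measure_eq_AE) auto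
  also have "prob ?D = 1 / 8 ^ (periods P - m)"
    using assms by (subst prob_shocks_are) (auto simp: PiE_def)
  finally show ?thesis by simp
qed

text \<open>By independence each path event has a constant conditional probability, and the
  coefficients known at \<open>m\<close> factor out. With values in \<open>ennreal\<close> no
  integrability has to be checked.\<close>

lemma nn_cond_exp_shocks:
  assumes "m < periods P" "S \<subseteq> PiE {m..<periods P} (\<lambda>_. signs)"
    and "\<And>e. e \<in> S \<Longrightarrow> h e \<in> borel_measurable (filt P m)"
  shows "AE \<omega> in Omega P. nn_cond_exp (Omega P) (filt P m)
      (\<lambda>\<omega>. \<Sum>e\<in>S. h e \<omega> * indicator (shocks_are P {m..<periods P} e) \<omega>) \<omega>
    = (\<Sum>e\<in>S. h e \<omega> * ennreal (1 / 8 ^ (periods P - m)))"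
proof -
  let ?F = "filt P m" and ?D = "shocks_are P {m..<periods P}" and ?c = "ennreal (1 / 8 ^ (periods P - m))"
  interpret finite_measure_subalgebra "Omega P" ?F
    using subalg_filt[of m] assms(1) by unfold_locales simp
  have D [measurable]: "?D e \<in> events" for e
    by (rule shocks_are_sets) auto
  \<comment> \<open>The constant passes the integral test that characterises
    \<open>nn_cond_exp\<close>, because the probability of \<open>A \<inter> ?D e\<close>
    factorises.\<close>
  have base: "AE \<omega> in Omega P. ?c = nn_cond_exp (Omega P) ?F (indicator (?D e)) \<omega>" if "e \<in> S" for e
  proof (rule nn_cond_exp_charact)
    fix A assume A: "A \<in> sets ?F"
    then have [measurable]: "A \<in> events" using subalg by (auto simp: subalgebra_def)
    have "(\<integral>\<^sup>+\<omega>\<in>A. indicator (?D e) \<omega> \<partial>Omega P) = emeasure (Omega P) (A \<inter> ?D e)"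
      by (simp add: indicator_inter_arith[symmetric] Int_commute)
    also have "\<dots> = ennreal (prob A / 8 ^ (periods P - m))"
      using prob_filt_Int_shocks[OF assms(1) A, of e] assms(2) that by (auto simp: emeasure_eq_measure)
    also have "\<dots> = (\<integral>\<^sup>+\<omega>\<in>A. ?c \<partial>Omega P)"
      by (simp add: nn_integral_cmult_indicator emeasure_eq_measure ennreal_mult'[symmetric])
    finally show "(\<integral>\<^sup>+\<omega>\<in>A. indicator (?D e) \<omega> \<partial>Omega P) = (\<integral>\<^sup>+\<omega>\<in>A. ?c \<partial>Omega P)" .
  qed auto
  have h [measurable]: "h e \<in> borel_measurable (Omega P)" if "e \<in> S" for e
    using assms(1,3) that measurable_from_subalg[OF subalg] by blast
  have "finite S"
    using assms(2) by (rule finite_subset) (simp add: finite_PiE)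
  then show ?thesis
    using base h assms(3)
  proof (induction S rule: finite_induct)
    case empty
    have "AE \<omega> in Omega P. 0 = nn_cond_exp (Omega P) ?F (\<lambda>_. 0) \<omega>"
      by (rule nn_cond_exp_F_meas) simp
    then show ?case by simp
  next
    case (insert e S)
    have [measurable]: "h e \<in> borel_measurable (Omega P)" "\<And>e. e \<in> S \<Longrightarrow> h e \<in> borel_measurable (Omega P)"
      using insert.prems by auto
    have "AE \<omega> in Omega P. nn_cond_exp (Omega P) ?F (\<lambda>\<omega>. h e \<omega> * indicator (?D e) \<omega>) \<omega>
        + nn_cond_exp (Omega P) ?F (\<lambda>\<omega>. \<Sum>e\<in>S. h e \<omega> * indicator (?D e) \<omega>) \<omega>
        = nn_cond_exp (Omega P) ?F (\<lambda>\<omega>. h e \<omega> * indicator (?D e) \<omega>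
          + (\<Sum>e\<in>S. h e \<omega> * indicator (?D e) \<omega>)) \<omega>"
      by (rule nn_cond_exp_sum) measurable
    moreover have "AE \<omega> in Omega P. h e \<omega> * nn_cond_exp (Omega P) ?F (indicator (?D e)) \<omega>
        = nn_cond_exp (Omega P) ?F (\<lambda>\<omega>. h e \<omega> * indicator (?D e) \<omega>) \<omega>"
      using insert.prems by (intro nn_cond_exp_prod) auto
    moreover note insert.prems(1)[of e, simplified]
    moreover have "AE \<omega> in Omega P. nn_cond_exp (Omega P) ?F
        (\<lambda>\<omega>. \<Sum>e\<in>S. h e \<omega> * indicator (?D e) \<omega>) \<omega> = (\<Sum>e\<in>S. h e \<omega> * ?c)"
      using insert by auto
    ultimately show ?case
    proof eventually_elim
      case (elim \<omega>)
      show ?case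
        unfolding sum.insert[OF insert.hyps]
        using elim(1,2)[symmetric] elim(3,4) by (simp only:)
    qed
  qed
qed

text \<open>Strategies may be unbounded, so \<open>f\<close> need not be integrable. The proof therefore treats the
  positive and negative parts separately with \<open>nn_cond_exp\<close>.\<close>

lemma real_cond_exp_avg:
  assumes "m < periods P" "f \<in> borel_measurable (Omega P)"
    and f: "AE \<omega> in Omega P. f \<omega> = g \<omega> (restrict (\<lambda>i. shock P i \<omega>) {m..<periods P})"
    and g: "\<And>e. e \<in> PiE {m..<periods P} (\<lambda>_. signs) \<Longrightarrow> (\<lambda>\<omega>. g \<omega> e) \<in> borel_measurable (filt P m)"
  shows "AE \<omega> in Omega P. real_cond_exp (Omega P) (filt P m) f \<omega> = avg {m..<periods P} (g \<omega>)"
proof -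
  let ?F = "filt P m" and ?D = "shocks_are P {m..<periods P}" and ?c = "1 / 8 ^ (periods P - m) :: real"
  let ?E = "PiE {m..<periods P} (\<lambda>_. signs)"
  interpret finite_measure_subalgebra "Omega P" ?F
    using subalg_filt[of m] assms(1) by unfold_locales simp
  note [measurable] = assms(2)
  have D [measurable]: "?D e \<in> events" for e
    by (rule shocks_are_sets) auto
  have gM [measurable]: "(\<lambda>\<omega>. g \<omega> e) \<in> borel_measurable (Omega P)" if "e \<in> ?E" for e
    using g[OF that] measurable_from_subalg[OF subalg] by blast
  have fin: "finite ?E" by (simp add: finite_PiE)
  \<comment> \<open>\<open>s\<close> will be 1 and -1. As \<open>ennreal\<close> cuts off negative
    values, this covers both parts of \<open>f\<close>. Almost surely exactly one path event occurs,
    so a single summand survives.\<close>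
  have split: "AE \<omega> in Omega P. ennreal (s * f \<omega>)
      = (\<Sum>e\<in>?E. ennreal (s * g \<omega> e) * indicator (?D e) \<omega>)" for s
    using f AE_shock AE_space
  proof eventually_elim
    case (elim \<omega>)
    let ?e = "restrict (\<lambda>i. shock P i \<omega>) {m..<periods P}"
    have "?e \<in> ?E" using elim by auto
    moreover have "indicator (?D e) \<omega> = (if e = ?e then 1 else 0 :: ennreal)" if "e \<in> ?E" for e
    proof -
      have "\<omega> \<in> ?D e \<longleftrightarrow> e = ?e"
        using that elim by (auto simp: shocks_are_def PiE_def extensional_def fun_eq_iff)
      then show ?thesis by (metis indicator_simps)
    qed
    ultimately have "(\<Sum>e\<in>?E. ennreal (s * g \<omega> e) * indicator (?D e) \<omega>) = ennreal (s * g \<omega> ?e)"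
      using fin by (simp add: if_distrib[of "(*) _"] sum.delta' cong: if_cong)
    then show ?case using elim by simp
  qed
  have nn: "AE \<omega> in Omega P. enn2real (nn_cond_exp (Omega P) ?F (\<lambda>\<omega>. ennreal (s * f \<omega>)) \<omega>)
      = (\<Sum>e\<in>?E. max 0 (s * g \<omega> e) * ?c)" for s
  proof -
    have "AE \<omega> in Omega P. nn_cond_exp (Omega P) ?F (\<lambda>\<omega>. ennreal (s * f \<omega>)) \<omega>
        = nn_cond_exp (Omega P) ?F (\<lambda>\<omega>. \<Sum>e\<in>?E. ennreal (s * g \<omega> e) * indicator (?D e) \<omega>) \<omega>"
      by (rule nn_cond_exp_cong[OF split]) measurable
    moreover have "AE \<omega> in Omega P.
        nn_cond_exp (Omega P) ?F (\<lambda>\<omega>. \<Sum>e\<in>?E. ennreal (s * g \<omega> e) * indicator (?D e) \<omega>) \<omega>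
        = (\<Sum>e\<in>?E. ennreal (s * g \<omega> e) * ennreal ?c)"
      using g by (intro nn_cond_exp_shocks assms(1)) auto
    ultimately show ?thesis
    proof eventually_elim
      case (elim \<omega>)
      have c: "?c \<ge> 0" by simp
      have mx: "ennreal (max 0 x) = ennreal x" for x
        by (simp add: max_def ennreal_neg)
      have "(\<Sum>e\<in>?E. ennreal (s * g \<omega> e) * ennreal ?c) = (\<Sum>e\<in>?E. ennreal (max 0 (s * g \<omega> e) * ?c))"
        by (intro sum.cong refl) (simp only: mx ennreal_mult[OF max.cobounded1 c])
      also have "\<dots> = ennreal (\<Sum>e\<in>?E. max 0 (s * g \<omega> e) * ?c)"
        by (rule sum_ennreal) simp
      finally show ?case
        using elim by (simp add: sum_nonneg)
    qed
  qed
  show ?thesis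
    using nn[of 1] nn[of "- 1"]
  proof eventually_elim
    case (elim \<omega>)
    have "real_cond_exp (Omega P) ?F f \<omega>
        = (\<Sum>e\<in>?E. max 0 (g \<omega> e) * ?c) - (\<Sum>e\<in>?E. max 0 (- g \<omega> e) * ?c)"
      using elim by (simp add: real_cond_exp_def)
    also have "\<dots> = (\<Sum>e\<in>?E. g \<omega> e * ?c)"
      unfolding sum_subtractf[symmetric] by (intro sum.cong refl) (auto simp: max_def algebra_simps)
    finally show ?case by (simp add: avg_def sum_divide_distrib)
  qed
qed

text \<open>\<open>real_cond_exp_avg\<close> is used first for the two means and then for the
  product of the deviations, whose coefficients are again known at \<open>m\<close>.\<close>

lemma cond_cov_avg:
  assumes "m < periods P" "X \<in> borel_measurable (Omega P)" "Y \<in> borel_measurable (Omega P)"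
    and X: "AE \<omega> in Omega P. X \<omega> = g \<omega> (restrict (\<lambda>i. shock P i \<omega>) {m..<periods P})"
    and g: "\<And>e. e \<in> PiE {m..<periods P} (\<lambda>_. signs) \<Longrightarrow> (\<lambda>\<omega>. g \<omega> e) \<in> borel_measurable (filt P m)"
    and Y: "AE \<omega> in Omega P. Y \<omega> = h \<omega> (restrict (\<lambda>i. shock P i \<omega>) {m..<periods P})"
    and h: "\<And>e. e \<in> PiE {m..<periods P} (\<lambda>_. signs) \<Longrightarrow> (\<lambda>\<omega>. h \<omega> e) \<in> borel_measurable (filt P m)"
  shows "AE \<omega> in Omega P. cond_cov (Omega P) (filt P m) X Y \<omega>
    = avg {m..<periods P} (\<lambda>e. (g \<omega> e - avg {m..<periods P} (g \<omega>)) * (h \<omega> e - avg {m..<periods P} (h \<omega>)))"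
  unfolding cond_cov_def
proof (rule real_cond_exp_avg[OF assms(1)])
  have EX: "AE \<omega> in Omega P. real_cond_exp (Omega P) (filt P m) X \<omega> = avg {m..<periods P} (g \<omega>)"
    by (rule real_cond_exp_avg[OF assms(1,2) X g])
  have EY: "AE \<omega> in Omega P. real_cond_exp (Omega P) (filt P m) Y \<omega> = avg {m..<periods P} (h \<omega>)"
    by (rule real_cond_exp_avg[OF assms(1,3) Y h])
  note [measurable] = assms(2,3)
  show "(\<lambda>\<omega>. (X \<omega> - real_cond_exp (Omega P) (filt P m) X \<omega>)
      * (Y \<omega> - real_cond_exp (Omega P) (filt P m) Y \<omega>)) \<in> borel_measurable (Omega P)"
    by measurable
  show "AE \<omega> in Omega P. (X \<omega> - real_cond_exp (Omega P) (filt P m) X \<omega>)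
      * (Y \<omega> - real_cond_exp (Omega P) (filt P m) Y \<omega>)
    = (g \<omega> (restrict (\<lambda>i. shock P i \<omega>) {m..<periods P}) - avg {m..<periods P} (g \<omega>))
      * (h \<omega> (restrict (\<lambda>i. shock P i \<omega>) {m..<periods P}) - avg {m..<periods P} (h \<omega>))"
    using X Y EX EY by eventually_elim simp
  have "(\<lambda>\<omega>. avg {m..<periods P} (g \<omega>)) \<in> borel_measurable (filt P m)"
    "(\<lambda>\<omega>. avg {m..<periods P} (h \<omega>)) \<in> borel_measurable (filt P m)"
    unfolding avg_def using g h by measurable
  then show "(\<lambda>\<omega>. (g \<omega> e - avg {m..<periods P} (g \<omega>)) * (h \<omega> e - avg {m..<periods P} (h \<omega>)))
      \<in> borel_measurable (filt P m)" if "e \<in> PiE {m..<periods P} (\<lambda>_. signs)" for e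
    using g[OF that] h[OF that] by measurable
qed

end

section \<open>Conditional law of final wealth and benchmark\<close>

definition growth :: "'a market \<Rightarrow> real \<times> real \<times> real \<Rightarrow> real" where
  "growth P t = 1 + (mu3 P * step P + sigma3 P * sqrt (step P)
     * (a31 P * fst t + a32 P * fst (snd t) + a33 P * snd (snd t)))"

definition pay_factor :: "'a market \<Rightarrow> nat \<Rightarrow> real" where
  "pay_factor P i = exp (income_growth P * time P (i + income_date P))"

definition income_mean :: "'a market \<Rightarrow> real" where
  "income_mean P = (\<bar>mu2 P * step P + sigma2 P * sqrt (step P)\<bar>
                   + \<bar>mu2 P * step P - sigma2 P * sqrt (step P)\<bar>) / 2"

text \<open>The centred part of what period \<open>i\<close> adds to wealth at investment
  \<open>x\<close>; \<open>gain_mean\<close> is its deterministic part.\<close>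

definition noise :: "'a market \<Rightarrow> real \<Rightarrow> nat \<Rightarrow> real \<times> real \<times> real \<Rightarrow> real" where
  "noise P x i t = x * (sigma1 P * sqrt (step P)) * fst t + pay_factor P i * income_amp P * fst (snd t)"

definition gain_mean :: "'a market \<Rightarrow> real \<Rightarrow> nat \<Rightarrow> real" where
  "gain_mean P x i = x * (mu1 P * step P) + pay_factor P i * income_mean P"

definition stock_loss :: "'a market \<Rightarrow> real \<Rightarrow> real" where
  "stock_loss P x = (exp (- risk_aversion P * (x * (mu1 P * step P + sigma1 P * sqrt (step P))))
                   + exp (- risk_aversion P * (x * (mu1 P * step P - sigma1 P * sqrt (step P))))) / 2"

definition income_loss :: "'a market \<Rightarrow> nat \<Rightarrow> real" where
  "income_loss P i = (exp (- risk_aversion P * (pay_factor P i * (income_mean P + income_amp P)))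
                    + exp (- risk_aversion P * (pay_factor P i * (income_mean P - income_amp P)))) / 2"

section \<open>One-period moments\<close>

lemma stock_loss_pos: "stock_loss P x > 0"
  by (simp add: stock_loss_def add_pos_pos)

lemma income_loss_pos: "income_loss P i > 0"
  by (simp add: income_loss_def add_pos_pos)

text \<open>A function on two signs is affine: half the sum of its values is the constant term, half
  their difference the slope. This removes the absolute value.\<close>

lemma abs_income:
  "x \<in> {-1, 1} \<Longrightarrow> \<bar>mu2 P * step P + sigma2 P * sqrt (step P) * x\<bar> = income_mean P + income_amp P * x"
  by (auto simp: income_mean_def income_amp_def field_simps)

lemma avg1_noise: "avg1 (noise P x i) = 0"
  by (simp add: avg1_eq noise_def)

lemma avg1_noise_square:
  "avg1 (\<lambda>t. (noise P x i t)\<^sup>2) = x\<^sup>2 * (sigma1 P * sqrt (step P))\<^sup>2 + (pay_factor P i)\<^sup>2 * (income_amp P)\<^sup>2"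
  by (simp add: avg1_eq noise_def power2_eq_square algebra_simps)

lemma avg1_growth: "avg1 (growth P) = mu3_tilde P"
  by (simp add: avg1_eq growth_def mu3_tilde_def algebra_simps)

text \<open>Only the stock and income loadings of the benchmark correlate with wealth. The factor
  \<open>mu3_tilde P\<close> is split off to fit \<open>avg_sum_mult_prod\<close>.\<close>

lemma avg1_noise_growth:
  assumes "mu3_tilde P \<noteq> 0"
  shows "avg1 (\<lambda>t. noise P x i t * growth P t)
    = theta3 P * (x * (sigma1 P * sqrt (step P)) * a31 P + pay_factor P i * income_amp P * a32 P) * mu3_tilde P"
proof -
  have "avg1 (\<lambda>t. noise P x i t * growth P t) = sigma3 P * sqrt (step P)
      * (x * (sigma1 P * sqrt (step P)) * a31 P + pay_factor P i * income_amp P * a32 P)"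
    by (simp add: avg1_eq noise_def growth_def algebra_simps)
  then show ?thesis using assms by (simp add: theta3_def)
qed

text \<open>Stock and income shocks are independent, so the exponential moment factorises and the
  investment \<open>x\<close> is confined to \<open>stock_loss\<close>.\<close>

lemma avg1_exp_gain:
  "avg1 (\<lambda>t. exp (- risk_aversion P * (gain_mean P x i + noise P x i t))) = stock_loss P x * income_loss P i"
proof -
  have "exp (- risk_aversion P * (gain_mean P x i + noise P x i t))
      = exp (- risk_aversion P * (x * (mu1 P * step P + sigma1 P * sqrt (step P) * fst t)))
      * exp (- risk_aversion P * (pay_factor P i * (income_mean P + income_amp P * fst (snd t))))" for t
    by (simp add: gain_mean_def noise_def exp_add[symmetric] algebra_simps)
  then show ?thesis
    by (simp add: avg1_eq stock_loss_def income_loss_def) (simp add: field_simps)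
qed

section \<open>Decomposition at an intermediate date, and measurability\<close>

lemma wealth_split:
  "m \<le> k \<Longrightarrow> wealth P \<pi> k \<omega> = wealth P \<pi> m \<omega>
    + (\<Sum>i=m..<k. \<pi> i \<omega> * (mu1 P * step P + sigma1 P * sqrt (step P) * eps P Stock i \<omega>))"
  by (induction k rule: dec_induct) auto

lemma income_split:
  "m \<le> k \<Longrightarrow> income P k \<omega> = income P m \<omega>
    + (\<Sum>i=m..<k. pay_factor P i * \<bar>mu2 P * step P + sigma2 P * sqrt (step P) * eps P Income i \<omega>\<bar>)"
  by (induction k rule: dec_induct) (auto simp: pay_factor_def)

lemma benchmark_split:
  "m \<le> k \<Longrightarrow> benchmark P k \<omega> = benchmark P m \<omega> * (\<Prod>i=m..<k. growth P (shock P i \<omega>))"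
  by (induction k rule: dec_induct) (auto simp: growth_def shock_def algebra_simps)

lemma wealth_cong: "(\<And>i. i < m \<Longrightarrow> \<pi> i \<omega> = \<pi>' i \<omega>) \<Longrightarrow> wealth P \<pi> m \<omega> = wealth P \<pi>' m \<omega>"
  by (induction m) auto

lemma wealth_measurable:
  assumes "\<And>i. i < k \<Longrightarrow> \<pi> i \<in> borel_measurable F" "\<And>i. i < k \<Longrightarrow> eps P Stock i \<in> borel_measurable F"
  shows "wealth P \<pi> k \<in> borel_measurable F"
  using assms
proof (induction k)
  case (Suc k)
  then have [measurable]: "wealth P \<pi> k \<in> borel_measurable F" "\<pi> k \<in> borel_measurable F"
    "eps P Stock k \<in> borel_measurable F" by auto
  show ?case unfolding wealth.simps[abs_def] by measurable
qed (simp add: wealth.simps[abs_def])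

lemma income_measurable:
  assumes "\<And>i. i < k \<Longrightarrow> eps P Income i \<in> borel_measurable F"
  shows "income P k \<in> borel_measurable F"
  using assms
proof (induction k)
  case (Suc k)
  then have [measurable]: "income P k \<in> borel_measurable F" "eps P Income k \<in> borel_measurable F" by auto
  show ?case unfolding income.simps[abs_def] by measurable
qed (simp add: income.simps[abs_def])

lemma benchmark_measurable:
  assumes "\<And>i j. i < k \<Longrightarrow> eps P j i \<in> borel_measurable F"
  shows "benchmark P k \<in> borel_measurable F"
  using assms
proof (induction k)
  case (Suc k)
  then have [measurable]: "benchmark P k \<in> borel_measurable F" "eps P j k \<in> borel_measurable F" for j
    by auto
  show ?case unfolding benchmark.simps[abs_def] by measurable
qed (simp add: benchmark.simps[abs_def])

context market_setting
begin

text \<open>\<open>a33\<close> is chosen such that the squared loadings of the benchmark add up to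
  1.\<close>

lemma avg1_growth_square:
  "avg1 (\<lambda>t. (growth P t)\<^sup>2) = (mu3_tilde P)\<^sup>2 + (sigma3 P)\<^sup>2 * step P"
proof -
  have "(a33 P)\<^sup>2 = 1 - (a31 P)\<^sup>2 - (a32 P)\<^sup>2"
    using model by (simp add: market_model_def a33_def)
  moreover have "avg1 (\<lambda>t. (growth P t)\<^sup>2)
      = (mu3_tilde P)\<^sup>2 + (sigma3 P * sqrt (step P))\<^sup>2 * ((a31 P)\<^sup>2 + (a32 P)\<^sup>2 + (a33 P)\<^sup>2)"
    by (simp add: avg1_eq growth_def mu3_tilde_def power2_eq_square algebra_simps)
  ultimately show ?thesis
    using step_pos by (simp add: power_mult_distrib)
qed

lemma AE_benchmark_pos: "m \<le> periods P \<Longrightarrow> AE \<omega> in Omega P. benchmark P m \<omega> > 0"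
  using model by (simp add: market_model_def)

text \<open>Almost sure positivity of the benchmark yields positive growth at every sign triple, as
  each triple has probability 1/8. Opposite triples average to \<open>mu3_tilde P\<close>.\<close>

lemma mu3_tilde_pos: "mu3_tilde P > 0"
proof -
  have b0: "benchmark0 P > 0"
    using AE_benchmark_pos[of 0] by simp
  have "growth P t > 0" if "t \<in> signs" for t
  proof -
    have D: "prob (shocks_are P {0} (\<lambda>_. t)) = 1 / 8"
      using prob_shocks_are[of "{0}" "\<lambda>_. t"] periods_pos that by auto
    have "\<exists>\<omega>\<in>shocks_are P {0} (\<lambda>_. t). benchmark P 1 \<omega> > 0"
    proof (rule ccontr)
      assume "\<not> ?thesis"
      then have "AE \<omega> in Omega P. \<omega> \<notin> shocks_are P {0} (\<lambda>_. t)"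
        using AE_benchmark_pos[of 1] periods_pos by (auto elim!: eventually_mono)
      then have "prob (shocks_are P {0} (\<lambda>_. t)) = 0"
        using shocks_are_sets[of "{0}" "\<lambda>_. t"] periods_pos
        by (subst prob_eq_0) auto
      with D show False by simp
    qed
    then obtain \<omega> where "shock P 0 \<omega> = t" "benchmark P 1 \<omega> > 0"
      by (auto simp: shocks_are_def)
    then have "benchmark0 P * growth P t > 0"
      using benchmark_split[of 0 1 P \<omega>] by simp
    then show ?thesis using b0 by (simp add: zero_less_mult_iff)
  qed
  from this[of "(1,1,1)"] this[of "(-1,-1,-1)"] show ?thesis
    by (simp add: mem_signs_iff growth_def mu3_tilde_def algebra_simps)
qed

lemma avg1_growth_square_theta3:
  "avg1 (\<lambda>t. (growth P t)\<^sup>2) = (mu3_tilde P)\<^sup>2 * (1 + (theta3 P)\<^sup>2)"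
  using mu3_tilde_pos step_pos
  by (simp add: avg1_growth_square theta3_def power_divide power_mult_distrib field_simps)

end

text \<open>One problem of the backward induction: the later investments are already known to be
  almost surely the constants \<open>p\<close>, while the earlier ones and the candidate
  \<open>q\<close> are arbitrary.\<close>

locale market_stage = market_setting +
  fixes n :: nat and \<rho> \<pi> :: "nat \<Rightarrow> 'a \<Rightarrow> real" and q :: "'a \<Rightarrow> real" and p :: "nat \<Rightarrow> real"
  assumes n: "n \<in> {1..periods P}"
    and \<rho>: "adapted P \<rho>"
    and q: "q \<in> borel_measurable (filt P (periods P - n))"
    and \<pi>: "\<And>i. periods P - n < i \<Longrightarrow> i < periods P \<Longrightarrow> \<pi> i \<in> borel_measurable (filt P i)"
    and \<pi>_eq: "\<And>i. periods P - n < i \<Longrightarrow> i < periods P \<Longrightarrow> AE \<omega> in Omega P. \<pi> i \<omega> = p i"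
begin

abbreviation "m \<equiv> periods P - n"
abbreviation "J \<equiv> {m..<periods P}"

text \<open>With the later investments frozen to \<open>p\<close>, every position is visibly known
  at time \<open>m\<close>, as the path functionals in \<open>real_cond_exp_avg\<close>
  require.\<close>

definition position :: "'a \<Rightarrow> nat \<Rightarrow> real" where
  "position \<omega> i = (if i = m then q \<omega> else p i)"

definition base :: "'a \<Rightarrow> real" where
  "base \<omega> = wealth P \<rho> m \<omega> + income P m \<omega>"

lemma m_less: "m < periods P" and diff_m [simp]: "periods P - m = n"
  using n by auto

lemma J_eq: "J = insert m {m + 1..<periods P}"
  using m_less by auto

lemma splice_measurable: "i < periods P \<Longrightarrow> splice P n \<rho> q \<pi> i \<in> borel_measurable (filt P i)"
  using \<rho> q \<pi>[of i] by (auto simp: splice_def[abs_def] adapted_def not_less)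

lemma final_wealth_measurable: "final_wealth P (splice P n \<rho> q \<pi>) \<in> borel_measurable (Omega P)"
proof -
  have [measurable]: "wealth P (splice P n \<rho> q \<pi>) (periods P) \<in> borel_measurable (Omega P)"
  proof (rule wealth_measurable)
    show "splice P n \<rho> q \<pi> i \<in> borel_measurable (Omega P)" if "i < periods P" for i
      using measurable_filt_Omega[OF splice_measurable[OF that]] that by simp
  qed simp
  have [measurable]: "income P (periods P) \<in> borel_measurable (Omega P)"
    by (intro income_measurable) auto
  show ?thesis unfolding final_wealth_def[abs_def] by measurable
qed

lemma benchmark_periods_measurable: "benchmark P (periods P) \<in> borel_measurable (Omega P)"
  by (intro benchmark_measurable) auto

lemma base_measurable [measurable]: "base \<in> borel_measurable (filt P m)"
proof -
  have [measurable]: "wealth P \<rho> m \<in> borel_measurable (filt P m)"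
  proof (rule wealth_measurable)
    show "\<rho> i \<in> borel_measurable (filt P m)" if "i < m" for i
    proof (rule measurable_filt_mono)
      show "\<rho> i \<in> borel_measurable (filt P i)"
        using \<rho> that m_less unfolding adapted_def by simp
    qed (use that in simp)
  qed (rule eps_measurable_filt)
  have [measurable]: "income P m \<in> borel_measurable (filt P m)"
    using eps_measurable_filt by (intro income_measurable)
  show ?thesis unfolding base_def[abs_def] by measurable
qed

lemma position_measurable [measurable]: "(\<lambda>\<omega>. position \<omega> i) \<in> borel_measurable (filt P m)"
  unfolding position_def using q by simp

lemma final_wealth_eq:
  "AE \<omega> in Omega P. final_wealth P (splice P n \<rho> q \<pi>) \<omega>
    = base \<omega> + (\<Sum>i\<in>J. gain_mean P (position \<omega> i) i + noise P (position \<omega> i) i (restrict (\<lambda>i. shock P i \<omega>) J i))"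
proof -
  have "AE \<omega> in Omega P. \<forall>i\<in>{m + 1..<periods P}. \<pi> i \<omega> = p i"
    using \<pi>_eq by (intro AE_finite_allI) auto
  then show ?thesis
    using AE_shock
  proof eventually_elim
    case (elim \<omega>)
    have pos: "splice P n \<rho> q \<pi> i \<omega> = position \<omega> i" if "i \<in> J" for i
      using that elim(1) by (auto simp: splice_def position_def)
    have inc: "\<bar>mu2 P * step P + sigma2 P * sqrt (step P) * eps P Income i \<omega>\<bar>
        = income_mean P + income_amp P * eps P Income i \<omega>" if "i \<in> J" for i
      using elim(2) that by (intro abs_income) (auto simp: shock_def mem_signs_iff)
    have w: "wealth P (splice P n \<rho> q \<pi>) m \<omega> = wealth P \<rho> m \<omega>"
      by (intro wealth_cong) (simp add: splice_def)
    have "final_wealth P (splice P n \<rho> q \<pi>) \<omega> = base \<omega>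
        + (\<Sum>i\<in>J. splice P n \<rho> q \<pi> i \<omega> * (mu1 P * step P + sigma1 P * sqrt (step P) * eps P Stock i \<omega>)
          + pay_factor P i * \<bar>mu2 P * step P + sigma2 P * sqrt (step P) * eps P Income i \<omega>\<bar>)"
      using m_less
      by (simp add: final_wealth_def base_def wealth_split[of m "periods P"] w
          income_split[of m "periods P"] sum.distrib)
    also have "(\<Sum>i\<in>J. splice P n \<rho> q \<pi> i \<omega> * (mu1 P * step P + sigma1 P * sqrt (step P) * eps P Stock i \<omega>)
          + pay_factor P i * \<bar>mu2 P * step P + sigma2 P * sqrt (step P) * eps P Income i \<omega>\<bar>)
        = (\<Sum>i\<in>J. gain_mean P (position \<omega> i) i
          + noise P (position \<omega> i) i (restrict (\<lambda>i. shock P i \<omega>) J i))"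
      by (intro sum.cong refl)
        (simp only: pos inc, simp add: gain_mean_def noise_def shock_def algebra_simps)
    finally show ?case .
  qed
qed

lemma objective_eq:
  "AE \<omega> in Omega P. objective P n (splice P n \<rho> q \<pi>) \<omega>
    = - (exp (- risk_aversion P * base \<omega>) * income_loss P m
        * (\<Prod>i=m + 1..<periods P. stock_loss P (p i) * income_loss P i)) * stock_loss P (q \<omega>)"
proof -
  let ?g = "\<lambda>\<omega> e. utility P (base \<omega> + (\<Sum>i\<in>J. gain_mean P (position \<omega> i) i + noise P (position \<omega> i) i (e i)))"
  note [measurable] = final_wealth_measurable
  have "AE \<omega> in Omega P. objective P n (splice P n \<rho> q \<pi>) \<omega> = avg J (?g \<omega>)"
    unfolding objective_def
  proof (rule real_cond_exp_avg[OF m_less])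
    show "(\<lambda>\<omega>. utility P (final_wealth P (splice P n \<rho> q \<pi>) \<omega>)) \<in> borel_measurable (Omega P)"
      unfolding utility_def by measurable
    show "AE \<omega> in Omega P. utility P (final_wealth P (splice P n \<rho> q \<pi>) \<omega>) = ?g \<omega> (restrict (\<lambda>i. shock P i \<omega>) J)"
      using final_wealth_eq by eventually_elim simp
    show "(\<lambda>\<omega>. ?g \<omega> e) \<in> borel_measurable (filt P m)" for e
      unfolding utility_def gain_mean_def noise_def by measurable
  qed
  then show ?thesis
  proof eventually_elim
    case (elim \<omega>)
    have "?g \<omega> e = - exp (- risk_aversion P * base \<omega>)
        * (\<Prod>i\<in>J. exp (- risk_aversion P * (gain_mean P (position \<omega> i) i + noise P (position \<omega> i) i (e i))))" for e
      by (simp only: utility_def distrib_left[of _ "base \<omega>"] sum_distrib_left exp_add exp_sum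
          finite_atLeastLessThan mult_minus_left)
    then have "objective P n (splice P n \<rho> q \<pi>) \<omega> = - exp (- risk_aversion P * base \<omega>)
        * (\<Prod>i\<in>J. stock_loss P (position \<omega> i) * income_loss P i)"
      using avg_prod[of J "\<lambda>i t. exp (- risk_aversion P * (gain_mean P (position \<omega> i) i + noise P (position \<omega> i) i t))"]
      unfolding elim by (simp only: avg_cmult finite_atLeastLessThan avg1_exp_gain)
    also have "(\<Prod>i\<in>J. stock_loss P (position \<omega> i) * income_loss P i)
        = stock_loss P (q \<omega>) * income_loss P m * (\<Prod>i=m + 1..<periods P. stock_loss P (p i) * income_loss P i)"
    proof -
      have "(\<Prod>i=m + 1..<periods P. stock_loss P (position \<omega> i) * income_loss P i)
          = (\<Prod>i=m + 1..<periods P. stock_loss P (p i) * income_loss P i)"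
        by (intro prod.cong) (auto simp: position_def)
      then show ?thesis unfolding J_eq by (simp add: position_def)
    qed
    finally show ?case by (simp add: mult_ac)
  qed
qed

lemma sum_position:
  "(\<Sum>i\<in>J. position \<omega> i) = q \<omega> + (\<Sum>i=m + 1..<periods P. p i)"
  "(\<Sum>i\<in>J. (position \<omega> i)\<^sup>2) = (q \<omega>)\<^sup>2 + (\<Sum>i=m + 1..<periods P. (p i)\<^sup>2)"
proof -
  have "(\<Sum>i=m + 1..<periods P. position \<omega> i) = (\<Sum>i=m + 1..<periods P. p i)"
    "(\<Sum>i=m + 1..<periods P. (position \<omega> i)\<^sup>2) = (\<Sum>i=m + 1..<periods P. (p i)\<^sup>2)"
    by (auto intro!: sum.cong simp: position_def)
  then show "(\<Sum>i\<in>J. position \<omega> i) = q \<omega> + (\<Sum>i=m + 1..<periods P. p i)"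
    "(\<Sum>i\<in>J. (position \<omega> i)\<^sup>2) = (q \<omega>)\<^sup>2 + (\<Sum>i=m + 1..<periods P. (p i)\<^sup>2)"
    unfolding J_eq by (simp_all add: position_def)
qed

text \<open>The shift by \<open>income_date\<close> passes from payment dates to the periods in
  which the income is earned.\<close>

lemma sum_pay_factor:
  "(\<Sum>s = m + income_date P..<periods P + income_date P. exp (income_growth P * time P s))
    = (\<Sum>i\<in>J. pay_factor P i)"
  "(\<Sum>s = m + income_date P..<periods P + income_date P. exp (2 * income_growth P * time P s))
    = (\<Sum>i\<in>J. (pay_factor P i)\<^sup>2)"
  unfolding sum.shift_bounds_nat_ivl
  by (simp_all add: pay_factor_def exp_double[symmetric] mult.assoc)

text \<open>The summands are the coefficients \<open>c i\<close> of
  \<open>avg_sum_mult_prod\<close>: the sum is the conditional covariance with the benchmark,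
  divided by the conditional mean of the benchmark.\<close>

lemma covariance_eq:
  "(\<Sum>i\<in>J. theta3 P * (position \<omega> i * (sigma1 P * sqrt (step P)) * a31 P + pay_factor P i * income_amp P * a32 P))
    = b1 P * q \<omega> + b2 P n p"
  unfolding b2_def sum_pay_factor
  by (simp add: sum_distrib_left[symmetric] sum_distrib_right[symmetric] sum.distrib sum_position
      b1_def algebra_simps)

text \<open>The first factor is the conditional variance of the benchmark divided by its squared
  conditional mean, the sum is the conditional variance of wealth.\<close>

lemma variance_eq:
  "((1 + (theta3 P)\<^sup>2) ^ n - 1)
     * (\<Sum>i\<in>J. (position \<omega> i)\<^sup>2 * (sigma1 P * sqrt (step P))\<^sup>2 + (pay_factor P i)\<^sup>2 * (income_amp P)\<^sup>2)
    = (k1 P n)\<^sup>2 * (q \<omega>)\<^sup>2 + k2_sq P n p"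
proof -
  have "(k1 P n)\<^sup>2 = ((1 + (theta3 P)\<^sup>2) ^ n - 1) * (sigma1 P)\<^sup>2 * step P"
    using step_pos by (simp add: k1_def)
  moreover have "(sigma1 P * sqrt (step P))\<^sup>2 = (sigma1 P)\<^sup>2 * step P"
    using step_pos by (simp add: power_mult_distrib)
  ultimately show ?thesis
    unfolding k2_sq_def sum_pay_factor sum.distrib sum_distrib_right[symmetric] sum_position
    by (simp only:) (simp add: algebra_simps)
qed

lemma correl_eq:
  "AE \<omega> in Omega P. correl (Omega P) (filt P m) (final_wealth P (splice P n \<rho> q \<pi>)) (benchmark P (periods P)) \<omega>
    = (b1 P * q \<omega> + b2 P n p) / sqrt ((k1 P n)\<^sup>2 * (q \<omega>)\<^sup>2 + k2_sq P n p)"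
proof -
  let ?W = "final_wealth P (splice P n \<rho> q \<pi>)" and ?B = "benchmark P (periods P)"
  let ?S = "\<lambda>\<omega> e. \<Sum>i\<in>J. noise P (position \<omega> i) i (e i)" and ?\<mu> = "mu3_tilde P"
  let ?C = "\<lambda>\<omega>. base \<omega> + (\<Sum>i\<in>J. gain_mean P (position \<omega> i) i)"
  let ?G = "\<lambda>e. \<Prod>i\<in>J. growth P (e i)"
  let ?g = "\<lambda>\<omega> e. ?C \<omega> + ?S \<omega> e"
  let ?h = "\<lambda>\<omega> e. benchmark P m \<omega> * ?G e"
  note [measurable] = final_wealth_measurable benchmark_periods_measurable
  have W: "AE \<omega> in Omega P. ?W \<omega> = ?g \<omega> (restrict (\<lambda>i. shock P i \<omega>) J)"
    using final_wealth_eq by eventually_elim (simp add: sum.distrib)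
  have gm: "(\<lambda>\<omega>. ?g \<omega> e) \<in> borel_measurable (filt P m)" for e
    unfolding gain_mean_def noise_def by measurable
  have B: "AE \<omega> in Omega P. ?B \<omega> = ?h \<omega> (restrict (\<lambda>i. shock P i \<omega>) J)"
    using m_less by (auto simp: benchmark_split[of m "periods P"])
  have [measurable]: "benchmark P m \<in> borel_measurable (filt P m)"
    using eps_measurable_filt by (intro benchmark_measurable)
  have hm: "(\<lambda>\<omega>. ?h \<omega> e) \<in> borel_measurable (filt P m)" for e
    by measurable
  have \<mu>: "?\<mu> > 0" by (rule mu3_tilde_pos)
  have S0: "avg J (?S \<omega>) = 0" for \<omega>
    using avg_sum_centered[of J "\<lambda>i. noise P (position \<omega> i) i"] by (simp add: avg1_noise)
  have SG: "avg J (\<lambda>e. ?S \<omega> e * ?G e) = (b1 P * q \<omega> + b2 P n p) * ?\<mu> ^ n" for \<omega>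
    using avg_sum_mult_prod[of J "growth P" ?\<mu> "\<lambda>i. noise P (position \<omega> i) i", OF _ avg1_growth avg1_noise_growth] \<mu>
    by (simp add: covariance_eq)
  have SS: "avg J (\<lambda>e. (?S \<omega> e)\<^sup>2)
      = (\<Sum>i\<in>J. (position \<omega> i)\<^sup>2 * (sigma1 P * sqrt (step P))\<^sup>2 + (pay_factor P i)\<^sup>2 * (income_amp P)\<^sup>2)" for \<omega>
    using avg_sum_square[of J "\<lambda>i. noise P (position \<omega> i) i"] by (simp add: avg1_noise avg1_noise_square)
  have G: "avg J ?G = ?\<mu> ^ n"
    using avg_prod[of J "\<lambda>_. growth P"] by (simp add: avg1_growth)
  have GG: "avg J (\<lambda>e. (?G e)\<^sup>2) = (?\<mu>\<^sup>2 * (1 + (theta3 P)\<^sup>2)) ^ n"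
    using avg_prod[of J "\<lambda>_ t. (growth P t)\<^sup>2"]
    by (simp add: avg1_growth_square_theta3 prod_power_distrib)
  have g_mean: "avg J (?g \<omega>) = ?C \<omega>" for \<omega>
    by (simp add: avg_add S0)
  have h_mean: "avg J (?h \<omega>) = benchmark P m \<omega> * ?\<mu> ^ n" for \<omega>
    by (simp add: avg_cmult G)
  have gg: "avg J (\<lambda>e. (?g \<omega> e - avg J (?g \<omega>)) * (?g \<omega> e - avg J (?g \<omega>))) = avg J (\<lambda>e. (?S \<omega> e)\<^sup>2)" for \<omega>
    unfolding g_mean by (simp add: power2_eq_square)
  have gh: "avg J (\<lambda>e. (?g \<omega> e - avg J (?g \<omega>)) * (?h \<omega> e - avg J (?h \<omega>)))
      = benchmark P m \<omega> * ((b1 P * q \<omega> + b2 P n p) * ?\<mu> ^ n)" for \<omega>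
  proof -
    have "(?g \<omega> e - avg J (?g \<omega>)) * (?h \<omega> e - avg J (?h \<omega>))
        = benchmark P m \<omega> * (?S \<omega> e * ?G e) - benchmark P m \<omega> * ?\<mu> ^ n * ?S \<omega> e" for e
      unfolding g_mean h_mean by (simp add: algebra_simps)
    \<comment> \<open>The benchmark's mean drops out because the wealth noise is centred.\<close>
    then show ?thesis by (simp only: avg_diff avg_cmult S0 SG mult_zero_right diff_zero)
  qed
  have hh: "avg J (\<lambda>e. (?h \<omega> e - avg J (?h \<omega>)) * (?h \<omega> e - avg J (?h \<omega>)))
      = (benchmark P m \<omega> * ?\<mu> ^ n)\<^sup>2 * ((1 + (theta3 P)\<^sup>2) ^ n - 1)" for \<omega>
  proof -
    have "(?h \<omega> e - avg J (?h \<omega>)) * (?h \<omega> e - avg J (?h \<omega>)) = (benchmark P m \<omega>)\<^sup>2 * (?G e)\<^sup>2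
        - (2 * (benchmark P m \<omega>)\<^sup>2 * ?\<mu> ^ n) * ?G e + (benchmark P m \<omega> * ?\<mu> ^ n)\<^sup>2" for e
      unfolding h_mean by (simp add: algebra_simps power2_eq_square)
    then have "avg J (\<lambda>e. (?h \<omega> e - avg J (?h \<omega>)) * (?h \<omega> e - avg J (?h \<omega>)))
        = (benchmark P m \<omega>)\<^sup>2 * (?\<mu>\<^sup>2 * (1 + (theta3 P)\<^sup>2)) ^ n
        - (2 * (benchmark P m \<omega>)\<^sup>2 * ?\<mu> ^ n) * ?\<mu> ^ n + (benchmark P m \<omega> * ?\<mu> ^ n)\<^sup>2"
      by (simp only: avg_diff avg_add avg_cmult G GG avg_const finite_atLeastLessThan)
    also have "(?\<mu>\<^sup>2 * (1 + (theta3 P)\<^sup>2)) ^ n = (?\<mu> ^ n)\<^sup>2 * (1 + (theta3 P)\<^sup>2) ^ n"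
      by (simp only: power_mult_distrib power_mult[symmetric] mult.commute[of 2 n])
    also have "(benchmark P m \<omega>)\<^sup>2 * ((?\<mu> ^ n)\<^sup>2 * (1 + (theta3 P)\<^sup>2) ^ n)
        - (2 * (benchmark P m \<omega>)\<^sup>2 * ?\<mu> ^ n) * ?\<mu> ^ n + (benchmark P m \<omega> * ?\<mu> ^ n)\<^sup>2
        = (benchmark P m \<omega> * ?\<mu> ^ n)\<^sup>2 * ((1 + (theta3 P)\<^sup>2) ^ n - 1)"
      by (simp add: power2_eq_square algebra_simps)
    finally show ?thesis .
  qed
  show ?thesis
    using AE_benchmark_pos[of m, simplified]
      cond_cov_avg[OF m_less final_wealth_measurable benchmark_periods_measurable W gm B hm]
      cond_cov_avg[OF m_less final_wealth_measurable final_wealth_measurable W gm W gm]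
      cond_cov_avg[OF m_less benchmark_periods_measurable benchmark_periods_measurable B hm B hm]
  proof eventually_elim
    case (elim \<omega>)
    let ?b = "benchmark P m \<omega> * ?\<mu> ^ n" and ?T = "(1 + (theta3 P)\<^sup>2) ^ n - 1"
    have b: "?b > 0" using elim(1) \<mu> by simp
    have "correl (Omega P) (filt P m) ?W ?B \<omega>
        = ?b * (b1 P * q \<omega> + b2 P n p) / (sqrt (avg J (\<lambda>e. (?S \<omega> e)\<^sup>2)) * sqrt (?b\<^sup>2 * ?T))"
      unfolding correl_def elim(2-4) gg gh hh by (simp add: mult_ac)
    \<comment> \<open>Positivity of \<open>?b\<close> turns the root of its square into
      \<open>?b\<close>, which then cancels.\<close>
    also have "sqrt (avg J (\<lambda>e. (?S \<omega> e)\<^sup>2)) * sqrt (?b\<^sup>2 * ?T) = ?b * sqrt (?T * avg J (\<lambda>e. (?S \<omega> e)\<^sup>2))"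
      using b by (simp add: real_sqrt_mult)
    finally show ?case
      unfolding SS variance_eq by (simp only: mult_divide_mult_cancel_left[OF less_imp_neq[OF b, symmetric]])
  qed
qed

end

section \<open>Backward induction\<close>

text \<open>The two stock returns are \<open>s * (t + 1)\<close> and \<open>s * (t - 1)\<close>.
  They have opposite signs since \<bar>t\<bar> < 1, so \<open>exp_sum_strict_min\<close> applies and
  its \<open>x0\<close> is \<open>pi_bar\<close>.\<close>

lemma stock_loss_strict_min:
  assumes "step P > 0" "sigma1 P \<noteq> 0" "risk_aversion P > 0" "\<bar>theta P * sqrt (step P)\<bar> < 1"
    and "y \<le> r" "y \<noteq> min (pi_bar P) r"
  shows "stock_loss P (min (pi_bar P) r) < stock_loss P y"
proof -
  define \<gamma> u s t where "\<gamma> = risk_aversion P" and "u = mu1 P * step P"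
    and "s = sigma1 P * sqrt (step P)" and "t = theta P * sqrt (step P)"
  have s: "s \<noteq> 0" and u: "u = s * t" and \<gamma>: "\<gamma> > 0"
    using assms by (simp_all add: s_def u_def t_def \<gamma>_def theta_def)
  have t: "1 + t > 0" "1 - t > 0"
    using assms(4) by (auto simp: t_def abs_less_iff)
  have loss: "stock_loss P x = (exp (- (\<gamma> * (s * (1 + t))) * x) + exp (\<gamma> * (s * (1 - t)) * x)) / 2" for x
    by (simp add: stock_loss_def u_def[symmetric] s_def[symmetric] \<gamma>_def[symmetric] u algebra_simps)
  have bar: "pi_bar P = 1 / (2 * \<gamma> * s) * ln ((1 + t) / (1 - t))"
    by (simp add: pi_bar_def \<gamma>_def s_def t_def mult.assoc)
  show ?thesis
  proof (cases "s > 0")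
    case True
    have "ln ((\<gamma> * (s * (1 + t))) / (\<gamma> * (s * (1 - t)))) / (\<gamma> * (s * (1 + t)) + \<gamma> * (s * (1 - t))) = pi_bar P"
    proof -
      have "\<gamma> * (s * (1 + t)) + \<gamma> * (s * (1 - t)) = 2 * \<gamma> * s"
        by (simp add: algebra_simps)
      moreover have "(\<gamma> * (s * (1 + t))) / (\<gamma> * (s * (1 - t))) = (1 + t) / (1 - t)"
        using s \<gamma> by simp
      ultimately show ?thesis by (simp only: bar) simp
    qed
    then show ?thesis
      using exp_sum_strict_min[of "\<gamma> * (s * (1 + t))" "\<gamma> * (s * (1 - t))" y r] True t \<gamma> assms(5,6)
      by (simp add: loss)
  next
    case False
    \<comment> \<open>For negative volatility the two exponentials exchange roles.\<close>
    then have s': "- s > 0" using s by simp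
    have "ln ((\<gamma> * (- s * (1 - t))) / (\<gamma> * (- s * (1 + t)))) / (\<gamma> * (- s * (1 - t)) + \<gamma> * (- s * (1 + t)))
        = ln ((1 - t) / (1 + t)) / (- (2 * \<gamma> * s))"
    proof -
      have "\<gamma> * (- s * (1 - t)) + \<gamma> * (- s * (1 + t)) = - (2 * \<gamma> * s)"
        by (simp add: algebra_simps)
      moreover have "(\<gamma> * (- s * (1 - t))) / (\<gamma> * (- s * (1 + t))) = (1 - t) / (1 + t)"
        using s \<gamma> by simp
      ultimately show ?thesis by (simp only:)
    qed
    also have "\<dots> = pi_bar P"
      unfolding bar using t by (simp add: ln_div minus_divide_left)
    finally show ?thesis
      using exp_sum_strict_min[of "\<gamma> * (- s * (1 - t))" "\<gamma> * (- s * (1 + t))" y r]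
        mult_pos_pos[OF \<gamma> mult_pos_pos[OF s' t(1)]] mult_pos_pos[OF \<gamma> mult_pos_pos[OF s' t(2)]] assms(5,6)
      by (simp add: loss add.commute)
  qed
qed

text \<open>\<open>Q\<close> reads only investments after its own date, so \<open>p\<close> can be
  built backwards without disturbing the roots already found.\<close>

lemma Q_cong:
  assumes "\<And>i. periods P - n < i \<Longrightarrow> i < periods P \<Longrightarrow> p i = p' i"
  shows "Q P \<delta> n p = Q P \<delta> n p'"
proof -
  have "(\<Sum>i = periods P - n + 1..<periods P. p i) = (\<Sum>i = periods P - n + 1..<periods P. p' i)"
    "(\<Sum>i = periods P - n + 1..<periods P. (p i)\<^sup>2) = (\<Sum>i = periods P - n + 1..<periods P. (p' i)\<^sup>2)"
    using assms by (auto intro!: sum.cong)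
  then have "b2 P n p = b2 P n p'" "k2_sq P n p = k2_sq P n p'"
    by (simp_all add: b2_def k2_sq_def)
  then show ?thesis by (simp add: Q_def[abs_def])
qed

locale hedging_market = market_setting +
  fixes \<delta> :: real
  assumes theta_bound: "\<bar>theta P * sqrt (step P)\<bar> < 1"
    and nondegenerate: "income_amp P \<noteq> 0 \<or> mu1 P < 0"
    and \<delta>: "\<delta> \<in> {0<..<b1 P / k1 P (periods P)}"
begin

section \<open>Signs of the constants and existence of the candidate\<close>

lemma k1_nonneg: "k1 P n \<ge> 0"
  using step_pos by (simp add: k1_def)

text \<open>That the interval for \<delta> is nonempty already forces \<open>b1 P > 0\<close>, and
  with it nonzero volatilities.\<close>

lemma \<delta>_pos: "\<delta> > 0" and b1_pos: "b1 P > 0"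
proof -
  show "\<delta> > 0" using \<delta> by simp
  then have "b1 P / k1 P (periods P) > 0" using \<delta> by simp
  then show "b1 P > 0" using k1_nonneg[of "periods P"] by (auto simp: zero_less_divide_iff)
qed

lemma theta3_sigma1_nonzero: "theta3 P \<noteq> 0" "sigma1 P \<noteq> 0"
  using b1_pos by (auto simp: b1_def)

lemma risk_aversion_pos: "risk_aversion P > 0"
  using model by (simp add: market_model_def)

lemma power_theta3_gt_1: "n \<ge> 1 \<Longrightarrow> (1 + (theta3 P)\<^sup>2) ^ n > 1"
  using theta3_sigma1_nonzero by (intro one_less_power) auto

lemma k1_pos: "n \<ge> 1 \<Longrightarrow> k1 P n > 0"
  using power_theta3_gt_1[of n] step_pos theta3_sigma1_nonzero by (simp add: k1_def)

lemma k1_\<delta>_less: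
  assumes "n \<in> {1..periods P}"
  shows "k1 P n * \<delta> < b1 P"
proof -
  have "(1 + (theta3 P)\<^sup>2) ^ n \<le> (1 + (theta3 P)\<^sup>2) ^ periods P"
    using assms by (intro power_increasing) auto
  then have "k1 P n \<le> k1 P (periods P)"
    unfolding k1_def using step_pos by (intro real_sqrt_le_mono mult_right_mono) auto
  then have "k1 P n * \<delta> \<le> k1 P (periods P) * \<delta>"
    using \<delta>_pos by (intro mult_right_mono) auto
  also have "\<dots> < b1 P"
    using \<delta> k1_pos[of "periods P"] periods_pos by (simp add: pos_less_divide_eq mult.commute)
  finally show ?thesis .
qed

lemma k2_sq_nonneg: "k2_sq P n p \<ge> 0"
  using step_pos by (auto simp: k2_sq_def intro!: mult_nonneg_nonneg add_nonneg_nonneg sum_nonneg)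

lemma k2_sq_pos:
  assumes "n \<in> {1..periods P}" "income_amp P \<noteq> 0"
  shows "k2_sq P n p > 0"
proof -
  have "(\<Sum>s = periods P - n + income_date P..<periods P + income_date P. exp (2 * income_growth P * time P s)) > 0"
    using assms(1) by (intro sum_pos) auto
  then have "(income_amp P)\<^sup>2 * (\<Sum>s = periods P - n + income_date P..<periods P + income_date P.
      exp (2 * income_growth P * time P s)) > 0"
    using assms(2) by simp
  moreover have "(sigma1 P)\<^sup>2 * step P * (\<Sum>i = periods P - n + 1..<periods P. (p i)\<^sup>2) \<ge> 0"
    using step_pos by (intro mult_nonneg_nonneg sum_nonneg) auto
  ultimately show ?thesis
    unfolding k2_sq_def using power_theta3_gt_1[of n] assms(1)
    by (intro mult_pos_pos) (simp, linarith)
qed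

lemma ex_left_root_Q: "n \<in> {1..periods P} \<Longrightarrow> \<exists>r. is_left_root (Q P \<delta> n p) r"
  unfolding Q_def[abs_def]
  using ex_left_root[OF b1_pos \<delta>_pos k1_nonneg k1_\<delta>_less k2_sq_nonneg] by blast

lemma constraint_iff:
  assumes "n \<in> {1..periods P}" "is_left_root (Q P \<delta> n p) r"
  shows "(b1 P * x + b2 P n p) / sqrt ((k1 P n)\<^sup>2 * x\<^sup>2 + k2_sq P n p) \<le> - \<delta>
    \<longleftrightarrow> x \<le> r \<and> (k1 P n)\<^sup>2 * x\<^sup>2 + k2_sq P n p > 0"
  using left_root_iff[OF b1_pos \<delta>_pos k1_nonneg k1_\<delta>_less[OF assms(1)] k2_sq_nonneg] assms(2)
  unfolding Q_def[abs_def] by blast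

text \<open>The logarithm has the sign of \<open>theta P\<close>, and the sign of the volatility
  cancels, leaving that of \<open>mu1 P\<close>.\<close>

lemma pi_bar_neg:
  assumes "mu1 P < 0"
  shows "pi_bar P < 0"
proof -
  let ?t = "theta P * sqrt (step P)"
  have t: "1 + ?t > 0" "1 - ?t > 0"
    using theta_bound by (auto simp: abs_less_iff)
  have "sgn (ln ((1 + ?t) / (1 - ?t))) = sgn ?t"
    using t by (auto simp: sgn_if ln_div)
  then have "sgn (pi_bar P) = sgn (sigma1 P) * sgn ?t"
    using risk_aversion_pos step_pos by (simp add: pi_bar_def sgn_mult sgn_divide)
  also have "\<dots> = sgn (mu1 P)"
    using theta3_sigma1_nonzero step_pos by (simp add: theta_def sgn_mult sgn_divide)
  finally show ?thesis using assms by (simp add: sgn_if split: if_splits)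
qed

text \<open>Either the income is random, or the candidate is a nonzero stock position because
  \<open>pi_bar P < 0\<close>.\<close>

lemma candidate_variance_pos:
  assumes "n \<in> {1..periods P}"
  shows "(k1 P n)\<^sup>2 * (min (pi_bar P) r)\<^sup>2 + k2_sq P n p > 0"
proof (cases "income_amp P = 0")
  case True
  then have "min (pi_bar P) r < 0" using nondegenerate pi_bar_neg by simp
  then have "(k1 P n)\<^sup>2 * (min (pi_bar P) r)\<^sup>2 > 0"
    using k1_pos[of n] assms by simp
  then show ?thesis using k2_sq_nonneg[of n p] by linarith
next
  case False
  then show ?thesis using k2_sq_pos[OF assms False, of p] by (simp add: add_nonneg_pos)
qed

lemma ex_candidate:
  "\<exists>p R. \<forall>n\<in>{1..periods P}.
     is_left_root (Q P \<delta> n p) (R (periods P - n)) \<and> p (periods P - n) = min (pi_bar P) (R (periods P - n))"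
proof -
  have "\<exists>p R. \<forall>n\<in>{1..k}.
     is_left_root (Q P \<delta> n p) (R (periods P - n)) \<and> p (periods P - n) = min (pi_bar P) (R (periods P - n))"
    if "k \<le> periods P" for k
    using that
  proof (induction k)
    case (Suc k)
    then obtain p R where IH: "\<And>n. n \<in> {1..k} \<Longrightarrow> is_left_root (Q P \<delta> n p) (R (periods P - n))
        \<and> p (periods P - n) = min (pi_bar P) (R (periods P - n))"
      by (meson Suc_leD)
    obtain r where r: "is_left_root (Q P \<delta> (Suc k) p) r"
      using ex_left_root_Q[of "Suc k" p] Suc.prems by auto
    let ?i = "periods P - Suc k"
    let ?p = "p(?i := min (pi_bar P) r)" and ?R = "R(?i := r)"
    have Q: "Q P \<delta> n ?p = Q P \<delta> n p" if "n \<in> {1..Suc k}" for n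
      using that by (intro Q_cong) auto
    have "is_left_root (Q P \<delta> n ?p) (?R (periods P - n)) \<and> ?p (periods P - n) = min (pi_bar P) (?R (periods P - n))"
      if "n \<in> {1..Suc k}" for n
    proof (cases "n = Suc k")
      case True
      then show ?thesis using r Q[OF that] by simp
    next
      case False
      then have "n \<in> {1..k}" "periods P - n \<noteq> ?i" using that Suc.prems by auto
      then show ?thesis using IH[of n] Q[OF that] by simp
    qed
    then show ?case by blast
  qed simp
  then show ?thesis by blast
qed

section \<open>Solving a single stage, then all of them\<close>

lemma feasible_iff:
  assumes "market_stage P n \<rho> \<pi> q p" "is_left_root (Q P \<delta> n p) r"
  shows "feasible P \<delta> n (splice P n \<rho> q \<pi>)
    \<longleftrightarrow> (AE \<omega> in Omega P. q \<omega> \<le> r \<and> (k1 P n)\<^sup>2 * (q \<omega>)\<^sup>2 + k2_sq P n p > 0)"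
proof -
  interpret market_stage P n \<rho> \<pi> q p by fact
  have "AE \<omega> in Omega P. correl (Omega P) (filt P m) (final_wealth P (splice P n \<rho> q \<pi>)) (benchmark P (periods P)) \<omega> \<le> - \<delta>
      \<longleftrightarrow> q \<omega> \<le> r \<and> (k1 P n)\<^sup>2 * (q \<omega>)\<^sup>2 + k2_sq P n p > 0"
    using correl_eq by eventually_elim (simp only: constraint_iff[OF n assms(2)])
  then show ?thesis
    unfolding feasible_def by (rule eventually_subst)
qed

text \<open>Both sides share the same past, hence the same negative factor, which reverses the
  inequality.\<close>

lemma objective_le_iff:
  assumes "market_stage P n \<rho> \<pi> q p" "market_stage P n \<rho> \<pi> q' p"
  shows "(AE \<omega> in Omega P. objective P n (splice P n \<rho> q' \<pi>) \<omega> \<le> objective P n (splice P n \<rho> q \<pi>) \<omega>)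
    \<longleftrightarrow> (AE \<omega> in Omega P. stock_loss P (q \<omega>) \<le> stock_loss P (q' \<omega>))"
proof -
  interpret market_stage P n \<rho> \<pi> q p by fact
  interpret q': market_stage P n \<rho> \<pi> q' p by fact
  have "AE \<omega> in Omega P. objective P n (splice P n \<rho> q' \<pi>) \<omega> \<le> objective P n (splice P n \<rho> q \<pi>) \<omega>
      \<longleftrightarrow> stock_loss P (q \<omega>) \<le> stock_loss P (q' \<omega>)"
    using objective_eq q'.objective_eq
  proof eventually_elim
    case (elim \<omega>)
    let ?c = "exp (- risk_aversion P * base \<omega>) * income_loss P m
        * (\<Prod>i=m + 1..<periods P. stock_loss P (p i) * income_loss P i)"
    have "?c > 0"
      by (intro mult_pos_pos prod_pos) (auto simp: stock_loss_pos income_loss_pos)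
    moreover have "q'.base = base"
      by (simp add: fun_eq_iff base_def q'.base_def)
    ultimately show ?case
      unfolding elim by (simp only: minus_mult_left[symmetric] neg_le_iff_le mult_le_cancel_left_pos)
  qed
  then show ?thesis by (rule eventually_subst)
qed

lemma solves_problem_iff:
  assumes n: "n \<in> {1..periods P}" and r: "is_left_root (Q P \<delta> n p) r"
    and \<pi>: "\<And>i. periods P - n < i \<Longrightarrow> i < periods P \<Longrightarrow> \<pi> i \<in> borel_measurable (filt P i)"
      "\<And>i. periods P - n < i \<Longrightarrow> i < periods P \<Longrightarrow> AE \<omega> in Omega P. \<pi> i \<omega> = p i"
  shows "solves_problem P \<delta> n \<pi> q \<longleftrightarrow>
    q \<in> borel_measurable (filt P (periods P - n)) \<and> (AE \<omega> in Omega P. q \<omega> = min (pi_bar P) r)"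
proof (intro iffI conjI)
  let ?p = "min (pi_bar P) r"
  note strict_min = stock_loss_strict_min[OF step_pos theta3_sigma1_nonzero(2) risk_aversion_pos theta_bound, of _ r]
  have stage: "market_stage P n \<rho> \<pi> q p"
    if "adapted P \<rho>" "q \<in> borel_measurable (filt P (periods P - n))" for \<rho> q
    using that n \<pi> by unfold_locales auto
  have var: "(k1 P n)\<^sup>2 * ?p\<^sup>2 + k2_sq P n p > 0"
    by (rule candidate_variance_pos[OF n])
  {
    assume sol: "solves_problem P \<delta> n \<pi> q"
    then show q: "q \<in> borel_measurable (filt P (periods P - n))"
      by (simp add: solves_problem_def)
    \<comment> \<open>A solution must work for every past, so testing it on one adapted past, here
      zero investment, suffices for uniqueness.\<close>
    let ?\<rho> = "\<lambda>_ _. 0 :: real" and ?q = "\<lambda>_. ?p"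
    have ad: "adapted P ?\<rho>" by (simp add: adapted_def)
    have st: "market_stage P n ?\<rho> \<pi> q p" "market_stage P n ?\<rho> \<pi> ?q p"
      using stage[OF ad q] stage[OF ad, of ?q] by auto
    have "feasible P \<delta> n (splice P n ?\<rho> ?q \<pi>)"
      using var by (subst feasible_iff[OF st(2) r]) simp
    then have "AE \<omega> in Omega P. objective P n (splice P n ?\<rho> ?q \<pi>) \<omega> \<le> objective P n (splice P n ?\<rho> q \<pi>) \<omega>"
      using sol ad unfolding solves_problem_def by simp
    then have "AE \<omega> in Omega P. stock_loss P (q \<omega>) \<le> stock_loss P ?p"
      by (simp only: objective_le_iff[OF st])
    moreover have "AE \<omega> in Omega P. q \<omega> \<le> r"
      using sol ad feasible_iff[OF st(1) r] unfolding solves_problem_def by auto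
    ultimately show "AE \<omega> in Omega P. q \<omega> = ?p"
      \<comment> \<open>A different admissible value would have a strictly larger loss than the
        feasible constant.\<close>
      by eventually_elim (use strict_min in force)
  next
    assume q: "q \<in> borel_measurable (filt P (periods P - n)) \<and> (AE \<omega> in Omega P. q \<omega> = ?p)"
    show "solves_problem P \<delta> n \<pi> q"
      unfolding solves_problem_def
    proof (intro conjI allI impI ballI)
      show "q \<in> borel_measurable (filt P (periods P - n))" using q by simp
      fix \<rho> :: "nat \<Rightarrow> 'a \<Rightarrow> real"
      assume ad: "adapted P \<rho>"
      have st: "market_stage P n \<rho> \<pi> q p" using stage[OF ad] q by simp
      have "AE \<omega> in Omega P. q \<omega> \<le> r \<and> (k1 P n)\<^sup>2 * (q \<omega>)\<^sup>2 + k2_sq P n p > 0"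
        using q[THEN conjunct2] by eventually_elim (use var in simp)
      then show "feasible P \<delta> n (splice P n \<rho> q \<pi>)"
        by (simp only: feasible_iff[OF st r])
      fix q'
      assume q': "q' \<in> borel_measurable (filt P (periods P - n))" "feasible P \<delta> n (splice P n \<rho> q' \<pi>)"
      have st': "market_stage P n \<rho> \<pi> q' p" using stage[OF ad q'(1)] .
      have "AE \<omega> in Omega P. q' \<omega> \<le> r"
        using q'(2) unfolding feasible_iff[OF st' r] by auto
      then have "AE \<omega> in Omega P. stock_loss P (q \<omega>) \<le> stock_loss P (q' \<omega>)"
        using q[THEN conjunct2] by eventually_elim (use strict_min in force)
      then show "AE \<omega> in Omega P. objective P n (splice P n \<rho> q' \<pi>) \<omega> \<le> objective P n (splice P n \<rho> q \<pi>) \<omega>"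
        by (simp only: objective_le_iff[OF st st'])
    qed
  }
qed

lemma subgame_perfect_iff:
  assumes "\<And>n. n \<in> {1..periods P} \<Longrightarrow> is_left_root (Q P \<delta> n p) (R (periods P - n))"
    and "\<And>n. n \<in> {1..periods P} \<Longrightarrow> p (periods P - n) = min (pi_bar P) (R (periods P - n))"
  shows "subgame_perfect P \<delta> \<pi> \<longleftrightarrow> adapted P \<pi> \<and>
    (\<forall>n\<in>{1..periods P}. AE \<omega> in Omega P. \<pi> (periods P - n) \<omega> = p (periods P - n))"
proof -
  have index: "\<exists>k\<in>{1..periods P}. i = periods P - k \<and> (periods P - n < i \<longrightarrow> k < n)"
    if "i < periods P" for i n
    using that by (intro bexI[of _ "periods P - i"]) auto
  have "\<pi> (periods P - n) \<in> borel_measurable (filt P (periods P - n))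
      \<and> (AE \<omega> in Omega P. \<pi> (periods P - n) \<omega> = p (periods P - n))"
    if "subgame_perfect P \<delta> \<pi>" "n \<in> {1..periods P}" for n
    using that(2)
  \<comment> \<open>Dates after \<open>periods P - n\<close> belong to stages below
    \<open>n\<close>. The induction hypothesis thus supplies the almost surely constant later
    investments required by \<open>solves_problem_iff\<close>.\<close>
  proof (induction n rule: less_induct)
    case (less n)
    have "\<pi> i \<in> borel_measurable (filt P i) \<and> (AE \<omega> in Omega P. \<pi> i \<omega> = p i)"
      if "periods P - n < i" "i < periods P" for i
      using index[OF that(2), of n] that less.IH by auto
    moreover have "solves_problem P \<delta> n \<pi> (\<pi> (periods P - n))"
      using \<open>subgame_perfect P \<delta> \<pi>\<close> less.prems by (simp add: subgame_perfect_def)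
    ultimately show ?case
      using solves_problem_iff[OF less.prems assms(1)[OF less.prems], of \<pi>]
      unfolding assms(2)[OF less.prems] by blast
  qed
  then have "adapted P \<pi> \<and> (\<forall>n\<in>{1..periods P}. AE \<omega> in Omega P. \<pi> (periods P - n) \<omega> = p (periods P - n))"
    if "subgame_perfect P \<delta> \<pi>"
    using that index unfolding adapted_def by blast
  moreover have "subgame_perfect P \<delta> \<pi>"
    if ad: "adapted P \<pi>"
      and eq: "\<forall>n\<in>{1..periods P}. AE \<omega> in Omega P. \<pi> (periods P - n) \<omega> = p (periods P - n)"
    unfolding subgame_perfect_def
  proof
    fix n
    assume n: "n \<in> {1..periods P}"
    have "\<pi> i \<in> borel_measurable (filt P i) \<and> (AE \<omega> in Omega P. \<pi> i \<omega> = p i)" if "i < periods P" for i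
      using index[OF that] ad eq that by (auto simp: adapted_def)
    then show "solves_problem P \<delta> n \<pi> (\<pi> (periods P - n))"
      using solves_problem_iff[OF n assms(1)[OF n], of \<pi>] n eq
      unfolding assms(2)[OF n, symmetric] by auto
  qed
  ultimately show ?thesis by blast
qed

end

theorem theorem4p1:
  fixes P :: "'a market" and \<delta> :: real
  assumes "market_model P"
    and "\<bar>theta P * sqrt (step P)\<bar> < 1"
    and "income_amp P \<noteq> 0 \<or> mu1 P < 0"
    and "\<delta> \<in> {0<..<b1 P / k1 P (periods P)}"
  shows "\<exists>p R :: nat \<Rightarrow> real.
    (\<forall>n\<in>{1..periods P}.
       is_left_root (Q P \<delta> n p) (R (periods P - n)) \<and>
       p (periods P - n) = min (pi_bar P) (R (periods P - n))) \<and>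
    (\<forall>\<pi> :: nat \<Rightarrow> 'a \<Rightarrow> real.
       subgame_perfect P \<delta> \<pi> \<longleftrightarrow>
       adapted P \<pi> \<and> (\<forall>n\<in>{1..periods P}.
         AE \<omega> in Omega P. \<pi> (periods P - n) \<omega> = p (periods P - n)))"
proof -
  interpret hedging_market P \<delta>
    using assms by unfold_locales
  obtain p R where pR: "\<forall>n\<in>{1..periods P}.
      is_left_root (Q P \<delta> n p) (R (periods P - n)) \<and> p (periods P - n) = min (pi_bar P) (R (periods P - n))"
    using ex_candidate by blast
  have "subgame_perfect P \<delta> \<pi> \<longleftrightarrow> adapted P \<pi> \<and>
      (\<forall>n\<in>{1..periods P}. AE \<omega> in Omega P. \<pi> (periods P - n) \<omega> = p (periods P - n))" for \<pi>
    by (rule subgame_perfect_iff[of p R]) (use pR in blast)+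
  with pR show ?thesis by blast
qed

end
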